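(* There exist absolute constants $c,C>0$ such that the following holds. Let $p\in[1,2]$ and let $p'$ be defined by $\frac1p+\frac1{p'}=1$ (with $p'=\infty$ if $p=1$). For every integer $n\ge1$ and every $\theta\in S^{n-1}$, $\theta$ is a $\psi_2$-direction of $B_p^n$, and the best (smallest) constant $C_\theta$ for which it is a $\psi_2$-direction satisfies $$c\,n^{1/p-1/2}\|\theta\|_{p'}\le C_\theta\le C\,n^{1/p-1/2}\|\theta\|_{p'}.$$
   Context: For $x\in\mathbb{R}^n$, $\|x\|_q=(\sum_{i=1}^n|x_i|^q)^{1/q}$ for $q<\infty$, $\|x\|_\infty=\max_i|x_i|$, and $B_p^n=\{x\in\mathbb{R}^n:\|x\|_p\le1\}$. $S^{n-1}$ is the Euclidean unit sphere. Let $\mu$ be the uniform probability measure on $B_p^n$ and, for measurable $f:\mathbb{R}^n\to\mathbb{R}$, let $\|f\|_{\psi_2(\mu)}=\inf\{\lambda>0:\int e^{|f/\lambda|^2}\,d\mu\le2\}$. A vector $\theta\in S^{n-1}$ is a $\psi_2$-direction of $B_p^n$ with constant $K>0$ if $f_\theta(x)=\langle x,\theta\rangle$ satisfies $\|f_\theta\|_{\psi_2(\mu)}\le K(\int|f_\theta|^2\,d\mu)^{1/2}$. *)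

theory Defs
  imports "HOL-Probability.Probability"
begin

text \<open>
  The dimension is bound inside the statement (the constants must not depend on it), so vectors
  of n-dimensional space are functions on \<open>{..<n}\<close>, extended by \<open>undefined\<close>; this is the space of
  the product of \<open>n\<close> copies of \<open>lborel\<close>, which is Lebesgue measure.
\<close>

definition lebesgue_n :: "nat \<Rightarrow> (nat \<Rightarrow> real) measure" where
  "lebesgue_n n = (\<Pi>\<^sub>M i\<in>{..<n}. lborel)"

definition inner_n :: "nat \<Rightarrow> (nat \<Rightarrow> real) \<Rightarrow> (nat \<Rightarrow> real) \<Rightarrow> real" where
  "inner_n n x y = (\<Sum>i<n. x i * y i)"

definition lp_norm :: "nat \<Rightarrow> ennreal \<Rightarrow> (nat \<Rightarrow> real) \<Rightarrow> real" where
  "lp_norm n q x =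
     (if q = \<infinity> then Max ((\<lambda>i. \<bar>x i\<bar>) ` {..<n})
      else (\<Sum>i<n. \<bar>x i\<bar> powr enn2real q) powr (1 / enn2real q))"

definition lp_ball :: "nat \<Rightarrow> ennreal \<Rightarrow> (nat \<Rightarrow> real) set" where
  "lp_ball n q = {x \<in> {..<n} \<rightarrow>\<^sub>E UNIV. lp_norm n q x \<le> 1}"

definition sphere_n :: "nat \<Rightarrow> (nat \<Rightarrow> real) set" where
  "sphere_n n = {x \<in> {..<n} \<rightarrow>\<^sub>E UNIV. lp_norm n 2 x = 1}"

text \<open>
  The integral is the nonnegative one, so a divergent integral is \<open>\<infinity>\<close> and not admissible;
  the norm is \<open>\<infinity>\<close> if no \<open>t\<close> is admissible.
\<close>

definition psi2_norm :: "'a measure \<Rightarrow> ('a \<Rightarrow> real) \<Rightarrow> ennreal" where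
  "psi2_norm \<mu> f =
     Inf {ennreal t | t. 0 < t \<and> (\<integral>\<^sup>+ x. ennreal (exp (\<bar>f x / t\<bar>\<^sup>2)) \<partial>\<mu>) \<le> 2}"

text \<open>
  On a bounded set \<open>B\<close> the linear functional is bounded, so the Bochner integral of its square is
  the true one.
\<close>

definition psi2_direction :: "nat \<Rightarrow> (nat \<Rightarrow> real) set \<Rightarrow> (nat \<Rightarrow> real) \<Rightarrow> real \<Rightarrow> bool" where
  "psi2_direction n B \<theta> K \<longleftrightarrow>
     (let \<mu> = uniform_measure (lebesgue_n n) B; f = (\<lambda>x. inner_n n x \<theta>)
      in 0 < K \<and> psi2_norm \<mu> f \<le> ennreal (K * sqrt (\<integral>x. \<bar>f x\<bar>\<^sup>2 \<partial>\<mu>)))"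

definition best_psi2_constant :: "nat \<Rightarrow> (nat \<Rightarrow> real) set \<Rightarrow> (nat \<Rightarrow> real) \<Rightarrow> real \<Rightarrow> bool" where
  "best_psi2_constant n B \<theta> K \<longleftrightarrow>
     psi2_direction n B \<theta> K \<and> (\<forall>K'. psi2_direction n B \<theta> K' \<longrightarrow> K \<le> K')"

end

theory Submission
  imports Defs "HOL-Real_Asymp.Real_Asymp"
begin

text \<open>Let \<open>h\<close> be the dual norm of \<open>\<theta>\<close>, that is, the maximum of \<open>f x = \<langle>x, \<theta>\<rangle>\<close> on the ball. Two estimates are
  needed: the \<open>\<psi>\<^sub>2\<close>-norm of \<open>f\<close> is of order \<open>h / sqrt n\<close>, and its standard deviation is of order
  \<open>n powr (- 1 / p)\<close>.

  A homogeneous function of degree \<open>q\<close> has the same integral over the ball as against the product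
  density \<open>exp (- \<Sum> \<bar>x i\<bar> powr p)\<close>, up to the factor \<open>Gamma ((n + q) / p + 1)\<close>. So the moments \<open>2 k\<close> of \<open>f\<close>
  with \<open>k \<le> n\<close> are controlled by one-dimensional exponential integrals, while for \<open>k > n\<close> the bound \<open>\<bar>f\<bar> \<le> h\<close>
  suffices; summing the exponential series gives the upper bound for the \<open>\<psi>\<^sub>2\<close>-norm. The lower bound holds
  because \<open>f \<ge> h / 3\<close> on a copy of the ball of relative volume \<open>1 / 3 ^ n\<close>. Since distinct coordinates are
  uncorrelated and equidistributed, the variance of \<open>f\<close> is that of one coordinate; it is bounded from
  below by averaging the Euclidean norm over the shell outside half of the ball.\<close>

section \<open>Lebesgue measure and dilates of the ball\<close>

lemma finite_product_lborel: "product_sigma_finite (\<lambda>_::nat. lborel :: real measure)"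
  by unfold_locales

lemma space_lebesgue_n: "space (lebesgue_n n) = {..<n} \<rightarrow>\<^sub>E UNIV"
  by (simp add: lebesgue_n_def space_PiM)

lemma sigma_finite_lebesgue_n: "sigma_finite_measure (lebesgue_n n)"
proof -
  interpret finite_product_sigma_finite "\<lambda>_::nat. lborel :: real measure" "{..<n}"
    by (unfold_locales) auto
  show ?thesis unfolding lebesgue_n_def by (rule sigma_finite_measure_axioms)
qed

lemma measurable_lebesgue_n_component:
  "i < n \<Longrightarrow> (\<lambda>x. x i) \<in> borel_measurable (lebesgue_n n)"
  unfolding lebesgue_n_def by (rule measurable_component_singleton[of i _ "\<lambda>_. lborel", simplified]) auto

lemma nn_integral_lebesgue_n_prod:
  assumes "\<And>i. i < n \<Longrightarrow> f i \<in> borel_measurable borel"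
  shows "(\<integral>\<^sup>+ x. (\<Prod>i<n. f i (x i)) \<partial>lebesgue_n n) = (\<Prod>i<n. \<integral>\<^sup>+ t. f i t \<partial>lborel)"
proof -
  interpret product_sigma_finite "\<lambda>_::nat. lborel :: real measure"
    by (rule finite_product_lborel)
  show ?thesis unfolding lebesgue_n_def using assms
    by (intro product_nn_integral_prod) auto
qed

text \<open>By uniqueness of the product measure it is enough to compare boxes, where the claim
  splits into one-dimensional substitutions. It is applied to dilations, to contractions towards a
  point and to the reflection of one coordinate.\<close>

lemma nn_integral_lebesgue_n_affine:
  fixes s c :: "nat \<Rightarrow> real"
  assumes c: "\<And>i. i < n \<Longrightarrow> c i \<noteq> 0"
    and f: "f \<in> borel_measurable (lebesgue_n n)"
  shows "(\<integral>\<^sup>+ x. f x \<partial>lebesgue_n n) =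
    (\<Prod>i<n. ennreal \<bar>c i\<bar>) * (\<integral>\<^sup>+ x. f (\<lambda>i\<in>{..<n}. s i + c i * x i) \<partial>lebesgue_n n)"
proof -
  interpret product_sigma_finite "\<lambda>_::nat. lborel :: real measure"
    by (rule finite_product_lborel)
  let ?T = "\<lambda>x. \<lambda>i\<in>{..<n}. s i + c i * x i"
  let ?P = "\<Prod>i<n. ennreal \<bar>c i\<bar>"
  have T[measurable]: "?T \<in> lebesgue_n n \<rightarrow>\<^sub>M lebesgue_n n"
  proof -
    have "(\<lambda>x. s i + c i * x i) \<in> lebesgue_n n \<rightarrow>\<^sub>M lborel" if "i \<in> {..<n}" for i
      using that measurable_lebesgue_n_component[of i n] by simp
    then show ?thesis
      by (subst (2) lebesgue_n_def) (rule measurable_restrict)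
  qed
  have "density (distr (lebesgue_n n) (lebesgue_n n) ?T) (\<lambda>_. ?P) = (\<Pi>\<^sub>M i\<in>{..<n}. lborel)"
  proof (rule PiM_eqI)
    show "sets (density (distr (lebesgue_n n) (lebesgue_n n) ?T) (\<lambda>_. ?P)) = sets (\<Pi>\<^sub>M i\<in>{..<n}. lborel)"
      by (simp add: lebesgue_n_def)
  next
    fix A :: "nat \<Rightarrow> real set"
    assume A: "\<And>i. i \<in> {..<n} \<Longrightarrow> A i \<in> sets lborel"
    have PA: "Pi\<^sub>E {..<n} A \<in> sets (lebesgue_n n)"
      unfolding lebesgue_n_def using A by (intro sets_PiM_I_finite) auto
    \<comment> \<open>The preimage of a box under a diagonal map is again a box, so its indicator
      factorises.\<close>
    have 1: "(\<Prod>i<n. indicator ((\<lambda>t. s i + c i * t) -` A i) (x i)) = (indicator (Pi\<^sub>E {..<n} A) (?T x) :: ennreal)" for x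
    proof (cases "\<forall>i<n. s i + c i * x i \<in> A i")
      case False
      then obtain j where "j < n" "s j + c j * x j \<notin> A j" by blast
      then show ?thesis
        by (subst prod_zero) (auto simp: indicator_def restrict_PiE_iff)
    qed (auto simp: indicator_def restrict_PiE_iff)
    have meas: "(\<lambda>t. s i + c i * t) -` A i \<in> sets borel" if "i < n" for i
      using measurable_sets[of "\<lambda>t. s i + c i * t" borel borel "A i"] A[of i] that by simp
    have "emeasure (density (distr (lebesgue_n n) (lebesgue_n n) ?T) (\<lambda>_. ?P)) (Pi\<^sub>E {..<n} A)
      = (\<integral>\<^sup>+ x. ?P * indicator (Pi\<^sub>E {..<n} A) (?T x) \<partial>lebesgue_n n)"
      using PA by (simp add: emeasure_density nn_integral_distr)
    also have "\<dots> = ?P * (\<integral>\<^sup>+ x. indicator (Pi\<^sub>E {..<n} A) (?T x) \<partial>lebesgue_n n)"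
      using PA by (subst nn_integral_cmult) auto
    also have "(\<integral>\<^sup>+ x. indicator (Pi\<^sub>E {..<n} A) (?T x) \<partial>lebesgue_n n)
        = (\<Prod>i<n. \<integral>\<^sup>+ t. indicator ((\<lambda>t. s i + c i * t) -` A i) t \<partial>lborel)"
      unfolding 1[symmetric] using meas by (intro nn_integral_lebesgue_n_prod) auto
    also have "?P * \<dots> = (\<Prod>i<n. ennreal \<bar>c i\<bar> * (\<integral>\<^sup>+ t. indicator (A i) (s i + c i * t) \<partial>lborel))"
      unfolding prod.distrib
      by (intro arg_cong2[where f="(*)"] prod.cong nn_integral_cong refl) (auto simp: indicator_def)
    also have "\<dots> = (\<Prod>i<n. emeasure lborel (A i))"
      using A c by (intro prod.cong refl) (subst nn_integral_real_affine[symmetric], auto)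
    finally show "emeasure (density (distr (lebesgue_n n) (lebesgue_n n) ?T) (\<lambda>_. ?P)) (Pi\<^sub>E {..<n} A) =
      (\<Prod>i<n. emeasure lborel (A i))" .
  qed simp
  then have "lebesgue_n n = density (distr (lebesgue_n n) (lebesgue_n n) ?T) (\<lambda>_. ?P)"
    by (simp add: lebesgue_n_def)
  then have "(\<integral>\<^sup>+ x. f x \<partial>lebesgue_n n) = (\<integral>\<^sup>+ x. f x \<partial>density (distr (lebesgue_n n) (lebesgue_n n) ?T) (\<lambda>_. ?P))"
    by simp
  also have "\<dots> = (\<integral>\<^sup>+ x. ?P * f (?T x) \<partial>lebesgue_n n)"
    using f by (simp add: nn_integral_density nn_integral_distr)
  also have "\<dots> = ?P * (\<integral>\<^sup>+ x. f (?T x) \<partial>lebesgue_n n)"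
    using measurable_compose[OF T f] by (rule nn_integral_cmult)
  finally show ?thesis .
qed

section \<open>Power sums and homogeneous functions on the ball\<close>

text \<open>The \<open>p\<close>-th power of the norm. Without the root,
  \<open>exp (- psum n p x)\<close> is a product over the coordinates, and dilation by
  \<open>c\<close> multiplies the sum by \<open>c powr p\<close>.\<close>

definition psum :: "nat \<Rightarrow> real \<Rightarrow> (nat \<Rightarrow> real) \<Rightarrow> real" where
  "psum n p x = (\<Sum>i<n. \<bar>x i\<bar> powr p)"

lemma psum_nonneg: "0 \<le> psum n p x"
  by (simp add: psum_def sum_nonneg)

lemma psum_measurable [measurable]: "psum n p \<in> borel_measurable (lebesgue_n n)"
  unfolding psum_def using measurable_lebesgue_n_component[measurable] by measurable

lemma inner_n_measurable [measurable]: "(\<lambda>x. inner_n n x \<theta>) \<in> borel_measurable (lebesgue_n n)"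
  unfolding inner_n_def using measurable_lebesgue_n_component[measurable] by measurable

lemma lp_norm_eq_psum: "0 \<le> p \<Longrightarrow> lp_norm n (ennreal p) x = psum n p x powr (1 / p)"
  by (simp add: lp_norm_def psum_def)

lemma lp_ball_eq:
  assumes "0 < p"
  shows "lp_ball n (ennreal p) = {x \<in> space (lebesgue_n n). psum n p x \<le> 1}"
proof -
  have "psum n p x powr (1 / p) \<le> 1 \<longleftrightarrow> psum n p x \<le> 1" for x
  proof (cases "psum n p x \<le> 1")
    case True
    then show ?thesis using powr_le1[of "1 / p" "psum n p x"] psum_nonneg[of n p x] assms by simp
  next
    case False
    then show ?thesis using powr_less_mono2[of "1 / p" 1 "psum n p x"] assms
      by (simp add: not_le)
  qed
  then show ?thesis using assms by (simp add: lp_ball_def lp_norm_eq_psum space_lebesgue_n)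
qed

lemma psum_scale: "0 \<le> c \<Longrightarrow> psum n p (\<lambda>i\<in>{..<n}. c * x i) = c powr p * psum n p x"
  by (simp add: psum_def sum_distrib_left abs_mult powr_mult)

lemma nn_integral_exp_tail:
  "(\<integral>\<^sup>+ r. ennreal (exp (- r)) * indicator {a..} r \<partial>lborel) = ennreal (exp (- a))"
proof -
  have "(\<integral>\<^sup>+ r. ennreal (exp (- r)) * indicator {a..} r \<partial>lborel) = ennreal (0 - (- exp (- a)))"
  proof (rule nn_integral_FTC_atLeast)
    show "((\<lambda>r::real. - exp (- r)) \<longlongrightarrow> 0) at_top"
      by real_asymp
  qed (auto intro!: derivative_eq_intros)
  then show ?thesis by simp
qed

text \<open>Writing \<open>exp (- psum n p x)\<close> as the integral of \<open>exp (- r)\<close> over \<open>r \<ge> psum n p x\<close> turns the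
  weighted integral into an average over dilates of the ball.\<close>

lemma nn_integral_homogeneous_exp:
  fixes F :: "(nat \<Rightarrow> real) \<Rightarrow> real"
  assumes p: "0 < p" and F[measurable]: "F \<in> borel_measurable (lebesgue_n n)"
    and F0: "\<And>x. 0 \<le> F x"
    and hom: "\<And>c x. 0 < c \<Longrightarrow> F (\<lambda>i\<in>{..<n}. c * x i) = c ^ q * F x"
  shows "(\<integral>\<^sup>+ x. ennreal (F x * exp (- psum n p x)) \<partial>lebesgue_n n) =
    ennreal (Gamma (real (n + q) / p + 1)) *
    (\<integral>\<^sup>+ x. ennreal (F x) * indicator (lp_ball n (ennreal p)) x \<partial>lebesgue_n n)"
proof -
  let ?B = "lp_ball n (ennreal p)" and ?L = "lebesgue_n n"
  interpret L: sigma_finite_measure ?L by (rule sigma_finite_lebesgue_n)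
  interpret pair_sigma_finite ?L "lborel :: real measure" by unfold_locales
  have B[measurable]: "?B \<in> sets ?L" unfolding lp_ball_eq[OF p] by measurable
  have dil: "(\<integral>\<^sup>+ x. ennreal (F x) * indicator {psum n p x..} r \<partial>?L) =
      ennreal (r powr (real (n + q) / p)) * (\<integral>\<^sup>+ x. ennreal (F x) * indicator ?B x \<partial>?L)" if r: "0 < r" for r
  proof -
    \<comment> \<open>Dilation by \<open>c\<close> carries the ball onto the set where
      \<open>psum n p x \<le> r\<close>; the Jacobian gives \<open>c ^ n\<close> and homogeneity
      gives \<open>c ^ q\<close>.\<close>
    define c where "c = r powr (1 / p)"
    have c: "0 < c" "c powr p = r" using r p by (auto simp: c_def powr_powr)
    have "(\<integral>\<^sup>+ x. ennreal (F x) * indicator {psum n p x..} r \<partial>?L) = (\<Prod>i<n. ennreal \<bar>c\<bar>) *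
       (\<integral>\<^sup>+ x. ennreal (F (\<lambda>i\<in>{..<n}. 0 + c * x i)) * indicator {psum n p (\<lambda>i\<in>{..<n}. 0 + c * x i)..} r \<partial>?L)"
    proof (rule nn_integral_lebesgue_n_affine)
      show "(\<lambda>x. ennreal (F x) * indicator {psum n p x..} r) \<in> borel_measurable ?L"
        by (simp add: indicator_def, measurable)
    qed (use c in auto)
    also have "(\<Prod>i<n. ennreal \<bar>c\<bar>) = ennreal (c ^ n)"
      using c by (simp add: ennreal_power)
    also have "(\<integral>\<^sup>+ x. ennreal (F (\<lambda>i\<in>{..<n}. 0 + c * x i)) * indicator {psum n p (\<lambda>i\<in>{..<n}. 0 + c * x i)..} r \<partial>?L)
       = (\<integral>\<^sup>+ x. ennreal (c ^ q) * (ennreal (F x) * indicator ?B x) \<partial>?L)"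
    proof (rule nn_integral_cong)
      fix x assume x: "x \<in> space ?L"
      have "psum n p (\<lambda>i\<in>{..<n}. 0 + c * x i) \<le> r \<longleftrightarrow> psum n p x \<le> 1"
        using c r by (simp add: psum_scale)
      then show "ennreal (F (\<lambda>i\<in>{..<n}. 0 + c * x i)) * indicator {psum n p (\<lambda>i\<in>{..<n}. 0 + c * x i)..} r
        = ennreal (c ^ q) * (ennreal (F x) * indicator ?B x)"
        using x c F0[of x] hom[of c x] by (auto simp: lp_ball_eq[OF p] indicator_def ennreal_mult)
    qed
    also have "\<dots> = ennreal (c ^ q) * (\<integral>\<^sup>+ x. ennreal (F x) * indicator ?B x \<partial>?L)"
      by (rule nn_integral_cmult) measurable
    also have "ennreal (c ^ n) * (ennreal (c ^ q) * (\<integral>\<^sup>+ x. ennreal (F x) * indicator ?B x \<partial>?L))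
       = ennreal (c ^ (n + q)) * (\<integral>\<^sup>+ x. ennreal (F x) * indicator ?B x \<partial>?L)"
      using c by (simp add: power_add ennreal_mult mult.assoc)
    also have "c ^ (n + q) = r powr (real (n + q) / p)"
      using c r by (simp add: c_def powr_powr flip: powr_realpow)
    finally show ?thesis .
  qed
  have "(\<integral>\<^sup>+ x. ennreal (F x * exp (- psum n p x)) \<partial>?L) =
     (\<integral>\<^sup>+ x. (\<integral>\<^sup>+ r. ennreal (F x) * (ennreal (exp (- r)) * indicator {psum n p x..} r) \<partial>lborel) \<partial>?L)"
    by (intro nn_integral_cong) (simp add: nn_integral_cmult nn_integral_exp_tail ennreal_mult F0)
  also have "\<dots> = (\<integral>\<^sup>+ r. (\<integral>\<^sup>+ x. ennreal (F x) * (ennreal (exp (- r)) * indicator {psum n p x..} r) \<partial>?L) \<partial>lborel)"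
    by (rule Fubini'[symmetric]) (simp add: indicator_def, measurable)
  also have "\<dots> = (\<integral>\<^sup>+ r. ennreal (indicator {0..} r * r powr (real (n + q) / p + 1 - 1) / exp r) *
      (\<integral>\<^sup>+ x. ennreal (F x) * indicator ?B x \<partial>?L) \<partial>lborel)"
  \<comment> \<open>The dilation formula covers \<open>r > 0\<close>. The point \<open>r = 0\<close>
    is null; for \<open>r < 0\<close> no \<open>x\<close> contributes on the left, and the indicator
    vanishes on the right.\<close>
  proof (rule nn_integral_cong_AE, rule AE_mp[OF AE_lborel_singleton[of 0]], rule AE_I2, rule impI)
    fix r :: real assume r0: "r \<noteq> 0"
    have eq: "(\<integral>\<^sup>+ x. ennreal (F x) * (ennreal (exp (- r)) * indicator {psum n p x..} r) \<partial>?L)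
       = ennreal (exp (- r)) * (\<integral>\<^sup>+ x. ennreal (F x) * indicator {psum n p x..} r \<partial>?L)"
      by (subst nn_integral_cmult[symmetric]) (auto simp: ac_simps indicator_def)
    show "(\<integral>\<^sup>+ x. ennreal (F x) * (ennreal (exp (- r)) * indicator {psum n p x..} r) \<partial>?L) =
      ennreal (indicator {0..} r * r powr (real (n + q) / p + 1 - 1) / exp r) * (\<integral>\<^sup>+ x. ennreal (F x) * indicator ?B x \<partial>?L)"
    proof (cases "0 < r")
      case True
      then show ?thesis unfolding eq dil[OF True]
        by (simp add: exp_minus field_simps flip: ennreal_mult mult.assoc)
    next
      case False
      then have "\<not> psum n p x \<le> r" for x using psum_nonneg[of n p x] r0 by linarith
      then show ?thesis using False r0 unfolding eq by (simp add: indicator_def)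
    qed
  qed
  also have "\<dots> = (\<integral>\<^sup>+ r. ennreal (indicator {0..} r * r powr (real (n + q) / p + 1 - 1) / exp r) \<partial>lborel) *
      (\<integral>\<^sup>+ x. ennreal (F x) * indicator ?B x \<partial>?L)"
    by (rule nn_integral_multc) measurable
  also have "(\<integral>\<^sup>+ r. ennreal (indicator {0..} r * r powr (real (n + q) / p + 1 - 1) / exp r) \<partial>lborel)
     = ennreal (Gamma (real (n + q) / p + 1))"
    using p by (intro Gamma_conv_nn_integral_real[symmetric]) (simp add: add_pos_nonneg add_nonneg_pos)
  finally show ?thesis .
qed

text \<open>\<open>ln (Gamma x)\<close> is convex, and \<open>a + 1\<close> is the mean of
  \<open>a\<close> and \<open>a + 1 + b\<close> with weights \<open>b / (b + 1)\<close> and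
  \<open>1 / (b + 1)\<close>; the recursion \<open>Gamma (a + 1) = a * Gamma a\<close> removes the
  value at \<open>a\<close>. This turns the Gamma quotient of the homogeneity formula into a power
  of \<open>n / p\<close>.\<close>

lemma Gamma_shift_ge:
  assumes "0 < a" "0 \<le> b"
  shows "a powr b * Gamma (a + 1) \<le> Gamma (a + 1 + b :: real)"
proof (cases "b = 0")
  case False
  with assms have b: "0 < b" by simp
  have rec: "ln (Gamma (a + 1)) = ln a + ln (Gamma a)"
    using assms Gamma_plus1[of a] Gamma_real_pos[of a] nonpos_Ints_nonpos[of a]
    by (metis ln_mult not_less mult.commute order_less_imp_le)
  have "(b / (b + 1)) * ln (Gamma a) + (1 / (b + 1)) * ln (Gamma (a + 1 + b)) \<ge> ln (Gamma (a + 1))"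
  proof -
    have "(\<lambda>x. ln (Gamma x)) ((1 - 1 / (b + 1)) *\<^sub>R a + (1 / (b + 1)) *\<^sub>R (a + 1 + b))
      \<le> (1 - 1 / (b + 1)) * ln (Gamma a) + (1 / (b + 1)) * ln (Gamma (a + 1 + b))"
      using log_convex_Gamma_real assms b by (intro convex_onD) (auto simp: o_def)
    moreover have "(1 - w) *\<^sub>R a + w *\<^sub>R (a + 1 + b) = a + w * (b + 1)" for w
      by (simp add: algebra_simps)
    from this[of "1 / (b + 1)"] have "(1 - 1 / (b + 1)) *\<^sub>R a + (1 / (b + 1)) *\<^sub>R (a + 1 + b) = a + 1"
      using b by (simp only:) simp
    moreover have "1 - 1 / (b + 1) = b / (b + 1)"
      using b by (simp add: field_simps)
    ultimately show ?thesis by simp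
  qed
  then have "(b + 1) * ln (Gamma (a + 1)) \<le>
      (b + 1) * ((b / (b + 1)) * ln (Gamma a) + (1 / (b + 1)) * ln (Gamma (a + 1 + b)))"
    using b by (intro mult_left_mono) auto
  also have "\<dots> = b * ln (Gamma a) + ln (Gamma (a + 1 + b))"
    using b by (simp add: distrib_left)
  finally have "b * ln a + ln (Gamma (a + 1)) \<le> ln (Gamma (a + 1 + b))"
    unfolding rec by (simp add: algebra_simps)
  then have "exp (b * ln a + ln (Gamma (a + 1))) \<le> exp (ln (Gamma (a + 1 + b)))" by simp
  then show ?thesis using assms by (simp add: exp_add powr_def Gamma_real_pos)
qed (use assms in simp)

section \<open>One-dimensional exponential integrals\<close>

text \<open>Term by term in the power series: \<open>a ^ n \<le> a\<^sup>2\<close> for even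
  \<open>n \<ge> 2\<close>, and the constant terms agree. The factor \<open>a\<^sup>2\<close> later
  makes the exponential moments quadratic in their parameter.\<close>

lemma cosh_scale_le:
  fixes a x :: real
  assumes "\<bar>a\<bar> \<le> 1"
  shows "cosh (a * x) \<le> 1 + a\<^sup>2 * (cosh x - 1)"
proof -
  let ?f = "\<lambda>x n. if even n then x ^ n /\<^sub>R fact n else (0::real)"
  have 1: "?f (a * x) sums cosh (a * x)" by (rule cosh_converges)
  have 2: "(\<lambda>n. (if n = 0 then 1 - a\<^sup>2 else 0) + a\<^sup>2 * ?f x n) sums ((1 - a\<^sup>2) + a\<^sup>2 * cosh x)"
    by (intro sums_add sums_mult cosh_converges) (use sums_single[of 0 "\<lambda>_. 1 - a\<^sup>2"] in simp)
  have "cosh (a * x) \<le> (1 - a\<^sup>2) + a\<^sup>2 * cosh x"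
  proof (rule sums_le[OF _ 1 2])
    fix n
    show "?f (a * x) n \<le> (if n = 0 then 1 - a\<^sup>2 else 0) + a\<^sup>2 * ?f x n"
    proof (cases "even n \<and> n \<noteq> 0")
      case True
      then obtain m where m: "n = 2 * m" "m \<ge> 1" by (auto elim!: evenE)
      have "a ^ n \<le> a\<^sup>2"
      proof -
        have "(a\<^sup>2) ^ m \<le> (a\<^sup>2) ^ 1"
          using m assms by (intro power_decreasing) (auto simp: abs_square_le_1)
        then show ?thesis by (simp add: m power_mult)
      qed
      moreover have "0 \<le> x ^ n" using True by (simp add: zero_le_even_power)
      ultimately have "a ^ n * x ^ n \<le> a\<^sup>2 * x ^ n" by (rule mult_right_mono)
      then show ?thesis using True
        by (simp add: power_mult_distrib field_simps)
    qed auto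
  qed
  then show ?thesis by (simp add: algebra_simps)
qed

lemma cosh_le_exp_abs: "cosh (x::real) \<le> exp \<bar>x\<bar>"
  by (simp add: cosh_def field_simps abs_if)

text \<open>One term of a series with nonnegative terms. This is the passage from even moments to
  exponential moments.\<close>

lemma power_even_le_cosh: "x ^ (2 * k) \<le> fact (2 * k) * cosh (x::real)"
proof -
  have "(\<Sum>n\<in>{2*k}. if even n then x ^ n /\<^sub>R fact n else (0::real)) \<le> cosh x"
  proof (rule order.trans[OF sum_le_suminf])
    show "summable (\<lambda>n. if even n then x ^ n /\<^sub>R fact n else (0::real))"
      using cosh_converges[of x] by (rule sums_summable)
    show "(\<Sum>n. if even n then x ^ n /\<^sub>R fact n else (0::real)) \<le> cosh x"
      using cosh_converges[of x] by (simp add: sums_iff)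
  qed (auto simp: zero_le_even_power)
  then show ?thesis by (simp add: field_simps)
qed

section \<open>Mass and moments of the one-dimensional density\<close>

text \<open>The known value is \<open>2 * Gamma (1 + 1 / p)\<close>. Its \<open>n\<close>-th power
  is absorbed into the volume of the ball, so positivity and finiteness suffice;
  \<open>enn2real\<close> would send an infinite mass to 0, which the lemma
  \<open>exp_powr_mass\<close> rules out for \<open>1 \<le> p\<close>.\<close>

definition exp_powr_mass :: "real \<Rightarrow> real" where
  "exp_powr_mass p = enn2real (\<integral>\<^sup>+ t. ennreal (exp (- (\<bar>t\<bar> powr p))) \<partial>lborel)"

text \<open>Substitute \<open>2 powr (1 / p) * t\<close> for \<open>t\<close>. Half of the exponent
  can thus be spent on a growing factor, at the price of a factor of at most 2 when
  \<open>1 \<le> p\<close>.\<close>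

lemma nn_integral_exp_powr_half:
  assumes "0 < p"
  shows "(\<integral>\<^sup>+ t. ennreal (exp (- (\<bar>t\<bar> powr p) / 2)) \<partial>lborel) =
    ennreal (2 powr (1 / p)) * (\<integral>\<^sup>+ t. ennreal (exp (- (\<bar>t\<bar> powr p))) \<partial>lborel)"
proof -
  have "\<bar>2 powr (1 / p) * t\<bar> powr p / 2 = \<bar>t\<bar> powr p" for t
    using assms by (simp add: abs_mult powr_mult powr_powr)
  then show ?thesis
    by (subst nn_integral_real_affine[of _ "2 powr (1 / p)" 0]) simp_all
qed

lemma abs_le_1_plus_powr: "1 \<le> p \<Longrightarrow> \<bar>t\<bar> \<le> 1 + \<bar>t::real\<bar> powr p"
  using powr_mono[of 1 p "\<bar>t\<bar>"] by (cases "\<bar>t\<bar> \<le> 1") (auto simp: add_increasing2)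

lemma exp_powr_mass:
  assumes p: "1 \<le> p"
  shows "(\<integral>\<^sup>+ t. ennreal (exp (- (\<bar>t\<bar> powr p))) \<partial>lborel) = ennreal (exp_powr_mass p)"
    and "0 < exp_powr_mass p"
proof -
  let ?I = "\<integral>\<^sup>+ t. ennreal (exp (- (\<bar>t\<bar> powr p))) \<partial>lborel"
  have half: "(\<integral>\<^sup>+ t. ennreal (exp (- t)) * indicator {0..} t \<partial>lborel) = 1"
    using nn_integral_exp_tail[of 0] by simp
  have half': "(\<integral>\<^sup>+ t. ennreal (exp t) * indicator {..0} t \<partial>lborel) = 1"
  proof -
    have "(\<integral>\<^sup>+ t. ennreal (exp t) * indicator {..0} t \<partial>lborel)
        = ennreal \<bar>-1\<bar> * (\<integral>\<^sup>+ t. ennreal (exp (0 + -1 * t)) * indicator {..0} (0 + -1 * t) \<partial>lborel)"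
      by (rule nn_integral_real_affine) auto
    also have "\<dots> = (\<integral>\<^sup>+ t. ennreal (exp (- t)) * indicator {0..} t \<partial>lborel)"
      by (simp add: indicator_def)
    finally show ?thesis using half by simp
  qed
  \<comment> \<open>Since \<open>\<bar>t\<bar> \<le> 1 + \<bar>t\<bar> powr p\<close>, the two-sided
    exponential times \<open>exp 1\<close> is a majorant.\<close>
  have "?I \<le> (\<integral>\<^sup>+ t. ennreal (exp 1) * (ennreal (exp (- t)) * indicator {0..} t + ennreal (exp t) * indicator {..0} t) \<partial>lborel)"
  proof (rule nn_integral_mono)
    fix t :: real
    have "exp (- (\<bar>t\<bar> powr p)) \<le> exp 1 * exp (- \<bar>t\<bar>)"
      using abs_le_1_plus_powr[OF p, of t] by (simp flip: exp_add)
    then have "ennreal (exp (- (\<bar>t\<bar> powr p))) \<le> ennreal (exp 1) * ennreal (exp (- \<bar>t\<bar>))"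
      by (simp flip: ennreal_mult)
    also have "\<dots> \<le> ennreal (exp 1) * (ennreal (exp (- t)) * indicator {0..} t + ennreal (exp t) * indicator {..0} t)"
      by (intro mult_left_mono) (auto simp: indicator_def)
    finally show "ennreal (exp (- (\<bar>t\<bar> powr p))) \<le> \<dots>" .
  qed
  also have "\<dots> = ennreal (exp 1) * 2"
    by (subst nn_integral_cmult) (auto simp: nn_integral_add half half')
  also have "\<dots> < \<infinity>" by (simp add: ennreal_mult_less_top)
  finally have fin: "?I < \<infinity>" .
  show 1: "?I = ennreal (exp_powr_mass p)" using fin by (simp add: exp_powr_mass_def)
  \<comment> \<open>On \<open>{0..1}\<close> the density is at least \<open>exp (- 1)\<close>, which
    gives positivity.\<close>
  have "ennreal (exp (- 1)) = (\<integral>\<^sup>+ t. ennreal (exp (- 1)) * indicator {0..1::real} t \<partial>lborel)"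
    by (subst nn_integral_cmult_indicator) auto
  also have "\<dots> \<le> ?I"
    using p by (intro nn_integral_mono) (auto simp: indicator_def powr_le1)
  finally have "?I \<noteq> 0" by (auto simp: ennreal_eq_0_iff)
  then show "0 < exp_powr_mass p" using 1 by (auto simp: ennreal_eq_0_iff not_le)
qed

lemma two_powr_inverse_le: "1 \<le> p \<Longrightarrow> 2 powr (1 / p) \<le> (2::real)"
  using powr_mono[of "1/p" 1 "2::real"] by simp

lemma exp_half_le_2: "exp (1 / 2) \<le> (2::real)"
proof -
  have "exp (1 / 2 :: real) ^ 2 \<le> 2 ^ 2"
    using exp_le by (simp flip: exp_of_nat_mult)
  then show ?thesis by (rule power2_le_imp_le) simp
qed

lemma cosh_half_le:
  assumes "1 \<le> p"
  shows "cosh (t / 2) \<le> 2 * exp (\<bar>t::real\<bar> powr p / 2)"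
proof -
  have "cosh (t / 2) \<le> exp (1 / 2) * exp (\<bar>t\<bar> powr p / 2)"
    using cosh_le_exp_abs[of "t/2"] abs_le_1_plus_powr[OF assms, of t]
    by (auto simp flip: exp_add intro: order.trans)
  also have "\<dots> \<le> 2 * exp (\<bar>t\<bar> powr p / 2)" using exp_half_le_2 by simp
  finally show ?thesis .
qed

lemma nn_integral_exp_powr_half_le:
  assumes p: "1 \<le> p"
  shows "(\<integral>\<^sup>+ t. ennreal (exp (- (\<bar>t\<bar> powr p) / 2)) \<partial>lborel) \<le> ennreal (2 * exp_powr_mass p)"
  using nn_integral_exp_powr_half[of p] exp_powr_mass[OF p] two_powr_inverse_le[OF p] p
  by (simp flip: ennreal_mult)

lemma nn_integral_exp_powr_second_moment:
  assumes p: "1 \<le> p"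
  shows "(\<integral>\<^sup>+ t. ennreal (t\<^sup>2 * exp (- (\<bar>t\<bar> powr p))) \<partial>lborel) \<le> ennreal (32 * exp_powr_mass p)"
proof -
  have "(\<integral>\<^sup>+ t. ennreal (t\<^sup>2 * exp (- (\<bar>t\<bar> powr p))) \<partial>lborel)
      \<le> (\<integral>\<^sup>+ t. ennreal 16 * ennreal (exp (- (\<bar>t\<bar> powr p) / 2)) \<partial>lborel)"
  proof (rule nn_integral_mono)
    fix t :: real
    \<comment> \<open>The 16 combines \<open>(t / 2)\<^sup>2 \<le> 2 * cosh (t / 2)\<close> with
      \<open>cosh (t / 2) \<le> 2 * exp (\<bar>t\<bar> powr p / 2)\<close>.\<close>
    have "t\<^sup>2 \<le> 16 * exp (\<bar>t\<bar> powr p / 2)"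
      using power_even_le_cosh[of "t/2" 1] cosh_half_le[OF p, of t] by (simp add: power2_eq_square)
    then have "t\<^sup>2 * exp (- (\<bar>t\<bar> powr p)) \<le> 16 * exp (\<bar>t\<bar> powr p / 2) * exp (- (\<bar>t\<bar> powr p))"
      by (rule mult_right_mono) simp
    then show "ennreal (t\<^sup>2 * exp (- (\<bar>t\<bar> powr p))) \<le> ennreal 16 * ennreal (exp (- (\<bar>t\<bar> powr p) / 2))"
      by (subst ennreal_mult[symmetric]) (simp_all add: mult.assoc flip: exp_add)
  qed
  also have "\<dots> = ennreal 16 * (\<integral>\<^sup>+ t. ennreal (exp (- (\<bar>t\<bar> powr p) / 2)) \<partial>lborel)"
    by (rule nn_integral_cmult) measurable
  also have "\<dots> \<le> ennreal 16 * ennreal (2 * exp_powr_mass p)"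
    by (intro mult_left_mono nn_integral_exp_powr_half_le p) auto
  also have "\<dots> = ennreal (32 * exp_powr_mass p)"
    using exp_powr_mass(2)[OF p] by (subst ennreal_mult[symmetric]) auto
  finally show ?thesis .
qed

text \<open>The weight is even, so \<open>exp (u * t)\<close> may be replaced by
  \<open>cosh (u * t)\<close>, which has no linear term. Comparison with \<open>cosh (t / 2)\<close>
  then bounds the excess over the mass by a multiple of \<open>u\<^sup>2\<close>.\<close>

lemma nn_integral_exp_powr_mgf_small:
  assumes p: "1 \<le> p" and u: "\<bar>u\<bar> \<le> 1 / 2"
  shows "(\<integral>\<^sup>+ t. ennreal (exp (u * t) * exp (- (\<bar>t\<bar> powr p))) \<partial>lborel)
    \<le> ennreal (exp (16 * u\<^sup>2) * exp_powr_mass p)"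
proof -
  let ?W = "\<lambda>u. \<integral>\<^sup>+ t. ennreal (exp (u * t) * exp (- (\<bar>t\<bar> powr p))) \<partial>lborel"
  let ?Z = "exp_powr_mass p"
  note Z = exp_powr_mass[OF p]
  have sym: "?W u = ?W (- u)"
    by (subst nn_integral_real_affine[of _ "-1" 0]) simp_all
  have "?W u + ?W (- u) = (\<integral>\<^sup>+ t. 2 * ennreal (cosh (u * t) * exp (- (\<bar>t\<bar> powr p))) \<partial>lborel)"
  proof (subst nn_integral_add[symmetric])
    show "(\<integral>\<^sup>+ t. ennreal (exp (u * t) * exp (- (\<bar>t\<bar> powr p))) + ennreal (exp (- u * t) * exp (- (\<bar>t\<bar> powr p))) \<partial>lborel)
      = (\<integral>\<^sup>+ t. 2 * ennreal (cosh (u * t) * exp (- (\<bar>t\<bar> powr p))) \<partial>lborel)"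
    proof (intro nn_integral_cong)
      fix t :: real
      have "ennreal (exp (u * t) * exp (- (\<bar>t\<bar> powr p))) + ennreal (exp (- u * t) * exp (- (\<bar>t\<bar> powr p)))
        = ennreal (2 * (cosh (u * t) * exp (- (\<bar>t\<bar> powr p))))"
        by (subst ennreal_plus[symmetric]) (auto simp: cosh_def algebra_simps)
      then show "ennreal (exp (u * t) * exp (- (\<bar>t\<bar> powr p))) + ennreal (exp (- u * t) * exp (- (\<bar>t\<bar> powr p)))
        = 2 * ennreal (cosh (u * t) * exp (- (\<bar>t\<bar> powr p)))"
        by (subst (asm) (3) ennreal_mult) auto
    qed
  qed auto
  also have "\<dots> = 2 * (\<integral>\<^sup>+ t. ennreal (cosh (u * t) * exp (- (\<bar>t\<bar> powr p))) \<partial>lborel)"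
    unfolding cosh_def by (rule nn_integral_cmult) measurable
  finally have "2 * ?W u = 2 * (\<integral>\<^sup>+ t. ennreal (cosh (u * t) * exp (- (\<bar>t\<bar> powr p))) \<partial>lborel)"
    using sym by (simp add: mult_2)
  then have "?W u = (\<integral>\<^sup>+ t. ennreal (cosh (u * t) * exp (- (\<bar>t\<bar> powr p))) \<partial>lborel)"
    by (simp add: ennreal_mult_cancel_left)
  also have "\<dots> \<le> (\<integral>\<^sup>+ t. ennreal (exp (- (\<bar>t\<bar> powr p))) + ennreal (8 * u\<^sup>2) * ennreal (exp (- (\<bar>t\<bar> powr p) / 2)) \<partial>lborel)"
  proof (rule nn_integral_mono)
    fix t :: real
    \<comment> \<open>The hypothesis \<open>\<bar>u\<bar> \<le> 1 / 2\<close> is what admits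
      \<open>2 * u\<close> as scale factor.\<close>
    have "cosh (u * t) \<le> 1 + (2 * u)\<^sup>2 * (cosh (t / 2) - 1)"
      using cosh_scale_le[of "2 * u" "t / 2"] u by simp
    also have "\<dots> \<le> 1 + (2 * u)\<^sup>2 * (2 * exp (\<bar>t\<bar> powr p / 2))"
      using cosh_half_le[OF p, of t] by (intro add_left_mono mult_left_mono) auto
    finally have "cosh (u * t) * exp (- (\<bar>t\<bar> powr p)) \<le> (1 + (2 * u)\<^sup>2 * (2 * exp (\<bar>t\<bar> powr p / 2))) * exp (- (\<bar>t\<bar> powr p))"
      by (rule mult_right_mono) simp
    also have "\<dots> = exp (- (\<bar>t\<bar> powr p)) + 8 * u\<^sup>2 * (exp (\<bar>t\<bar> powr p / 2) * exp (- (\<bar>t\<bar> powr p)))"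
      by (simp add: algebra_simps power2_eq_square)
    also have "exp (\<bar>t\<bar> powr p / 2) * exp (- (\<bar>t\<bar> powr p)) = exp (- (\<bar>t\<bar> powr p) / 2)"
      by (simp flip: exp_add)
    finally show "ennreal (cosh (u * t) * exp (- (\<bar>t\<bar> powr p))) \<le>
        ennreal (exp (- (\<bar>t\<bar> powr p))) + ennreal (8 * u\<^sup>2) * ennreal (exp (- (\<bar>t\<bar> powr p) / 2))"
      by (simp flip: ennreal_mult ennreal_plus)
  qed
  also have "\<dots> = ennreal ?Z + ennreal (8 * u\<^sup>2) * (\<integral>\<^sup>+ t. ennreal (exp (- (\<bar>t\<bar> powr p) / 2)) \<partial>lborel)"
    by (simp add: nn_integral_add nn_integral_cmult Z(1))
  also have "\<dots> \<le> ennreal ?Z + ennreal (8 * u\<^sup>2) * ennreal (2 * ?Z)"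
    by (intro add_left_mono mult_left_mono nn_integral_exp_powr_half_le p) auto
  also have "\<dots> = ennreal ((1 + 16 * u\<^sup>2) * ?Z)"
    using Z(2) by (simp add: algebra_simps flip: ennreal_mult ennreal_plus)
  also have "\<dots> \<le> ennreal (exp (16 * u\<^sup>2) * ?Z)"
    using Z(2) by (intro ennreal_leI mult_right_mono exp_ge_add_one_self) auto
  finally show ?thesis .
qed

text \<open>Young's inequality splits \<open>u * t\<close> into half of
  \<open>\<bar>t\<bar> powr p\<close>, which the weight absorbs, and a term of order
  \<open>\<bar>u\<bar> powr q\<close>.\<close>

lemma nn_integral_exp_powr_mgf_large:
  assumes p: "1 < p" and q: "1 / p + 1 / q = 1" and u: "1 / 2 \<le> \<bar>u\<bar>"
  shows "(\<integral>\<^sup>+ t. ennreal (exp (u * t) * exp (- (\<bar>t\<bar> powr p))) \<partial>lborel)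
    \<le> ennreal (exp (2 * (2 * \<bar>u\<bar>) powr q) * exp_powr_mass p)"
proof -
  let ?Z = "exp_powr_mass p"
  have q1: "1 < q"
  proof -
    have "1 / p < 1" "0 < 1 / p" using p by auto
    then have "1 / q < 1" "0 < 1 / q" using q by linarith+
    then show ?thesis by (simp add: field_simps)
  qed
  have p1: "1 \<le> p" using p by simp
  note Z = exp_powr_mass[OF p1]
  \<comment> \<open>With this \<open>a\<close>, Young's term
    \<open>(a * \<bar>t\<bar>) powr p / p\<close> is exactly half of
    \<open>\<bar>t\<bar> powr p\<close>; the bound \<open>1 / 2 \<le> a\<close> costs a factor 2 in
    front of \<open>\<bar>u\<bar>\<close>.\<close>
  define a where "a = (p / 2) powr (1 / p)"
  have a: "a powr p = p / 2" "0 < a" using p by (auto simp: a_def powr_powr)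
  have a2: "1 / 2 \<le> a"
  proof (rule ccontr)
    assume "\<not> 1 / 2 \<le> a"
    then have "a powr p < (1 / 2) powr p" using a p by (intro powr_less_mono2) auto
    also have "\<dots> \<le> (1 / 2) powr 1" using p by (intro powr_mono') auto
    finally show False using a p by simp
  qed
  have "(\<integral>\<^sup>+ t. ennreal (exp (u * t) * exp (- (\<bar>t\<bar> powr p))) \<partial>lborel)
    \<le> (\<integral>\<^sup>+ t. ennreal (exp ((2 * \<bar>u\<bar>) powr q)) * ennreal (exp (- (\<bar>t\<bar> powr p) / 2)) \<partial>lborel)"
  proof (rule nn_integral_mono)
    fix t :: real
    have "u * t \<le> \<bar>u\<bar> * \<bar>t\<bar>" by (metis abs_ge_self abs_mult)
    also have "\<dots> = (a * \<bar>t\<bar>) * (\<bar>u\<bar> / a)" using a by simp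
    also have "\<dots> \<le> (a * \<bar>t\<bar>) powr p / p + (\<bar>u\<bar> / a) powr q / q"
      using p q q1 a by (intro Youngs_inequality) auto
    also have "(a * \<bar>t\<bar>) powr p / p = \<bar>t\<bar> powr p / 2"
      using p by (simp add: powr_mult a(1))
    also have "(\<bar>u\<bar> / a) powr q / q \<le> (\<bar>u\<bar> / a) powr q"
      using q1 mult_right_mono[of 1 q "(\<bar>u\<bar> / a) powr q"] by (simp add: field_simps)
    also have "(\<bar>u\<bar> / a) powr q \<le> (2 * \<bar>u\<bar>) powr q"
    proof (rule powr_mono2)
      show "\<bar>u\<bar> / a \<le> 2 * \<bar>u\<bar>"
        using a a2 mult_left_mono[of "1/2" a "2 * \<bar>u\<bar>"] by (simp add: field_simps)
    qed (use q1 a in auto)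
    finally have "u * t \<le> \<bar>t\<bar> powr p / 2 + (2 * \<bar>u\<bar>) powr q" by simp
    then show "ennreal (exp (u * t) * exp (- (\<bar>t\<bar> powr p))) \<le>
      ennreal (exp ((2 * \<bar>u\<bar>) powr q)) * ennreal (exp (- (\<bar>t\<bar> powr p) / 2))"
      by (simp flip: ennreal_mult exp_add)
  qed
  also have "\<dots> = ennreal (exp ((2 * \<bar>u\<bar>) powr q)) * (\<integral>\<^sup>+ t. ennreal (exp (- (\<bar>t\<bar> powr p) / 2)) \<partial>lborel)"
    by (rule nn_integral_cmult) measurable
  also have "\<dots> \<le> ennreal (exp ((2 * \<bar>u\<bar>) powr q)) * ennreal (2 * ?Z)"
    by (intro mult_left_mono nn_integral_exp_powr_half_le p1) auto
  also have "\<dots> = ennreal (exp ((2 * \<bar>u\<bar>) powr q) * 2 * ?Z)"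
    using Z(2) by (simp flip: ennreal_mult add: mult.assoc)
  \<comment> \<open>The factor 2 from halving the exponent is absorbed by a second copy of the
    exponential, since \<open>2 * \<bar>u\<bar> \<ge> 1\<close>.\<close>
  also have "\<dots> \<le> ennreal (exp ((2 * \<bar>u\<bar>) powr q) * exp ((2 * \<bar>u\<bar>) powr q) * ?Z)"
  proof (intro ennreal_leI mult_right_mono mult_left_mono)
    have "1 \<le> (2 * \<bar>u\<bar>) powr q" using u q1 by (intro ge_one_powr_ge_zero) auto
    then show "2 \<le> exp ((2 * \<bar>u\<bar>) powr q)"
      using exp_ge_add_one_self[of "(2 * \<bar>u\<bar>) powr q"] by linarith
  qed (use Z(2) in auto)
  also have "\<dots> = ennreal (exp (2 * (2 * \<bar>u\<bar>) powr q) * ?Z)"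
    by (simp flip: exp_add)
  finally show ?thesis .
qed

section \<open>The dual norm\<close>

text \<open>The tangent at 1 of a concave power, obtained from Young's inequality for the pair
  \<open>t powr a\<close> and \<open>1\<close> with exponents \<open>1 / a\<close> and
  \<open>1 / (1 - a)\<close>.\<close>

lemma powr_le_affine:
  fixes t a :: real
  assumes "0 \<le> t" "0 < a" "a \<le> 1"
  shows "t powr a \<le> 1 + a * (t - 1)"
proof (cases "t = 0 \<or> a = 1")
  case True
  then show ?thesis using assms by auto
next
  case False
  have "t powr a * 1 \<le> (t powr a) powr (1 / a) / (1 / a) + 1 powr (1 / (1 - a)) / (1 / (1 - a))"
    using assms False by (intro Youngs_inequality) (auto simp: field_simps)
  also have "\<dots> = a * t + (1 - a)" using assms False by (simp add: powr_powr)
  finally show ?thesis by (simp add: algebra_simps)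
qed

lemma abs_powr_eq_square_powr: "\<bar>x::real\<bar> powr p = (x\<^sup>2) powr (p / 2)"
proof -
  have "x\<^sup>2 = \<bar>x\<bar> powr 2" by simp
  then show ?thesis by (simp only: powr_powr) simp
qed

text \<open>The power mean inequality: rescale the squares to mean 1 and apply the tangent line to
  each; the linear terms cancel in the sum.\<close>

lemma psum_le_square_sum:
  assumes p: "1 \<le> p" "p \<le> 2" and n: "1 \<le> n"
  shows "psum n p x \<le> real n powr (1 - p / 2) * (\<Sum>i<n. (x i)\<^sup>2) powr (p / 2)"
proof -
  define S where "S = (\<Sum>i<n. (x i)\<^sup>2)"
  have S0: "0 \<le> S" by (simp add: S_def sum_nonneg)
  show ?thesis
  proof (cases "S = 0")
    case True
    then have "x i = 0" if "i < n" for i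
      using that by (simp add: S_def sum_nonneg_eq_0_iff)
    then show ?thesis by (simp add: psum_def)
  next
    case False
    with S0 have S: "0 < S" by simp
    have "(\<Sum>i<n. (real n * (x i)\<^sup>2 / S) powr (p / 2)) \<le> (\<Sum>i<n. 1 + p / 2 * (real n * (x i)\<^sup>2 / S - 1))"
      using p S by (intro sum_mono powr_le_affine) auto
    also have "\<dots> = real n + p / 2 * (real n * (\<Sum>i<n. (x i)\<^sup>2) / S - real n)"
      by (simp add: sum.distrib sum_subtractf flip: sum_distrib_left sum_divide_distrib)
    also have "\<dots> = real n" using S by (simp flip: S_def)
    also have "(\<Sum>i<n. (real n * (x i)\<^sup>2 / S) powr (p / 2)) = (real n / S) powr (p / 2) * psum n p x"
      unfolding psum_def sum_distrib_left
      by (intro sum.cong refl) (simp add: abs_powr_eq_square_powr flip: powr_mult)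
    finally have "(real n / S) powr (p / 2) * psum n p x \<le> real n" .
    then have "psum n p x \<le> real n * S powr (p / 2) / real n powr (p / 2)"
      using S n by (simp add: powr_divide field_simps)
    also have "\<dots> = real n powr (1 - p / 2) * S powr (p / 2)"
      using n by (simp add: powr_diff)
    finally show ?thesis by (simp add: S_def)
  qed
qed

text \<open>Coordinatewise convexity of the power. It keeps the contracted copy used in the lower
  bound of the Orlicz norm inside the ball.\<close>

lemma psum_convex:
  assumes p: "1 \<le> p" and "0 \<le> a" "0 \<le> b" "a + b = 1"
  shows "psum n p (\<lambda>i\<in>{..<n}. a * x i + b * y i) \<le> a * psum n p x + b * psum n p y"
proof -
  have scal: "(c * w) powr p \<le> c * w powr p" if "0 \<le> c" "c \<le> 1" "0 \<le> w" for c w :: real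
    using that powr_mono'[of 1 p c] p by (simp add: powr_mult mult_right_mono)
  have conv: "(a * u + b * v) powr p \<le> a * u powr p + b * v powr p" if "0 \<le> u" "0 \<le> v" for u v :: real
  proof (cases "u = 0 \<or> v = 0")
    case True
    then show ?thesis using that assms scal[of a u] scal[of b v] by auto
  next
    case False
    then show ?thesis
      using convex_onD[OF powr_convex[OF p], of b u v] that assms
      by (simp add: eq_diff_eq[symmetric])
  qed
  have "\<bar>a * x i + b * y i\<bar> powr p \<le> a * \<bar>x i\<bar> powr p + b * \<bar>y i\<bar> powr p" for i
  proof -
    have "\<bar>a * x i + b * y i\<bar> \<le> a * \<bar>x i\<bar> + b * \<bar>y i\<bar>"
      using assms by (metis abs_mult abs_of_nonneg abs_triangle_ineq)
    then have "\<bar>a * x i + b * y i\<bar> powr p \<le> (a * \<bar>x i\<bar> + b * \<bar>y i\<bar>) powr p"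
      using p by (intro powr_mono2) auto
    also have "\<dots> \<le> a * \<bar>x i\<bar> powr p + b * \<bar>y i\<bar> powr p" by (rule conv) auto
    finally show ?thesis .
  qed
  then show ?thesis
    by (auto simp: psum_def sum_distrib_left simp flip: sum.distrib intro!: sum_mono)
qed

text \<open>In \<open>ennreal\<close>, \<open>1 / \<infinity> = 0\<close> and
  \<open>1 / 0 = \<infinity>\<close>, so an infinite \<open>p'\<close> forces \<open>p = 1\<close>
  and the exponent 0 is excluded. The bound \<open>2 \<le> q\<close>, which comes from
  \<open>p \<le> 2\<close>, serves in the estimate of the large coordinates.\<close>

lemma conjugate_exponent_cases:
  fixes p' :: ennreal
  assumes p: "1 \<le> p" "p \<le> 2" and conj: "1 / ennreal p + 1 / p' = 1"
  obtains "p = 1" "p' = \<infinity>"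
  | q where "1 < p" "2 \<le> q" "p' = ennreal q" "1 / p + 1 / q = 1"
proof (cases "p' = \<infinity>")
  case True
  then have "ennreal (1 / p) = 1" using conj p by (simp add: divide_ennreal flip: ennreal_1)
  then have "p = 1" by simp
  then show ?thesis using True that by blast
next
  case False
  then obtain q where q: "p' = ennreal q" "0 \<le> q" by (cases p') auto
  have "q \<noteq> 0"
  proof
    assume "q = 0"
    then show False using conj q by simp
  qed
  then have q0: "0 < q" using q by simp
  have "ennreal (1 / p + 1 / q) = 1 / ennreal p + 1 / ennreal q"
    using p q0 by (subst ennreal_plus) (auto simp: divide_ennreal simp flip: ennreal_1)
  then have "ennreal (1 / p + 1 / q) = 1" using conj q by simp
  then have eq: "1 / p + 1 / q = 1" by simp
  moreover have "p \<noteq> 1" using eq q0 by auto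
  moreover have "2 \<le> q"
  proof -
    have "1 / 2 \<le> 1 / p" using p by (simp add: field_simps)
    then have "1 / q \<le> 1 / 2" using eq by linarith
    then show ?thesis using q0 by (simp add: field_simps)
  qed
  ultimately show ?thesis using p q that by (metis less_eq_real_def)
qed

section \<open>Hoelder duality for a fixed unit direction\<close>

locale dual_direction =
  fixes p :: real and p' :: ennreal and n :: nat and \<theta> :: "nat \<Rightarrow> real"
  assumes p: "1 \<le> p" "p \<le> 2" and conj: "1 / ennreal p + 1 / p' = 1"
    and n: "1 \<le> n" and \<theta>: "\<theta> \<in> sphere_n n"
begin

abbreviation "h \<equiv> lp_norm n p' \<theta>"

lemma square_sum_\<theta>: "(\<Sum>i<n. (\<theta> i)\<^sup>2) = 1"
proof -
  have "(\<Sum>i<n. \<bar>\<theta> i\<bar> powr 2) powr (1 / 2) = 1"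
    using \<theta> by (simp add: sphere_n_def lp_norm_def)
  then have "sqrt (\<Sum>i<n. (\<theta> i)\<^sup>2) = 1"
    by (simp add: powr_half_sqrt sum_nonneg)
  then show ?thesis by simp
qed

lemma dual_norm_cases:
  obtains "p = 1" "h = Max ((\<lambda>i. \<bar>\<theta> i\<bar>) ` {..<n})"
  | q where "1 < p" "2 \<le> q" "1 / p + 1 / q = 1" "h = (\<Sum>i<n. \<bar>\<theta> i\<bar> powr q) powr (1 / q)"
  using p conj
proof (cases rule: conjugate_exponent_cases)
  case 1
  then show ?thesis using that(1) by (simp add: lp_norm_def)
next
  case (2 q)
  then show ?thesis using that(2) by (simp add: lp_norm_def)
qed

lemma dual_norm_pos: "0 < h"
proof -
  obtain j where j: "j < n" "\<theta> j \<noteq> 0"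
    using square_sum_\<theta> by (metis (no_types, lifting) lessThan_iff power_zero_numeral sum.neutral zero_neq_one)
  show ?thesis
  proof (cases rule: dual_norm_cases)
    case 1
    have "\<bar>\<theta> j\<bar> \<le> h" unfolding 1 using j by (intro Max_ge) auto
    then show ?thesis using j by simp
  next
    case (2 q)
    have "0 < (\<Sum>i<n. \<bar>\<theta> i\<bar> powr q)" using j by (intro sum_pos2[of _ j]) auto
    then show ?thesis unfolding 2 by simp
  qed
qed

lemma abs_\<theta>_le: "i < n \<Longrightarrow> p = 1 \<Longrightarrow> \<bar>\<theta> i\<bar> \<le> h"
  by (cases rule: dual_norm_cases) (auto intro!: Max_ge)

lemma psum_\<theta>_eq:
  assumes "0 < q" "h = (\<Sum>i<n. \<bar>\<theta> i\<bar> powr q) powr (1 / q)"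
  shows "psum n q \<theta> = h powr q"
  using assms by (simp add: powr_powr sum_nonneg psum_def)

text \<open>Hoelder's inequality. For \<open>p > 1\<close>, Young's inequality is applied to
  \<open>\<bar>x i\<bar>\<close> and \<open>\<bar>\<theta> i\<bar> / h\<close>, whose sums of powers
  are at most 1, so that the total is at most \<open>1 / p + 1 / q = 1\<close>.\<close>

lemma holder_ball:
  assumes x: "psum n p x \<le> 1"
  shows "\<bar>inner_n n x \<theta>\<bar> \<le> h"
proof -
  have "\<bar>inner_n n x \<theta>\<bar> \<le> (\<Sum>i<n. \<bar>x i\<bar> * \<bar>\<theta> i\<bar>)"
    unfolding inner_n_def by (rule order.trans[OF sum_abs]) (simp add: abs_mult)
  also have "\<dots> \<le> h"
  proof (cases rule: dual_norm_cases)
    case 1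
    have "(\<Sum>i<n. \<bar>x i\<bar> * \<bar>\<theta> i\<bar>) \<le> (\<Sum>i<n. \<bar>x i\<bar> * h)"
      using 1 abs_\<theta>_le by (intro sum_mono mult_left_mono) auto
    also have "\<dots> = psum n p x * h" using 1 by (simp add: psum_def sum_distrib_right)
    also have "\<dots> \<le> 1 * h" using x dual_norm_pos by (intro mult_right_mono) auto
    finally show ?thesis by simp
  next
    case (2 q)
    have h: "psum n q \<theta> = h powr q" using 2 by (intro psum_\<theta>_eq) auto
    have "(\<Sum>i<n. \<bar>x i\<bar> * \<bar>\<theta> i\<bar>) / h = (\<Sum>i<n. \<bar>x i\<bar> * (\<bar>\<theta> i\<bar> / h))"
      by (simp add: sum_divide_distrib)
    also have "\<dots> \<le> (\<Sum>i<n. \<bar>x i\<bar> powr p / p + (\<bar>\<theta> i\<bar> / h) powr q / q)"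
      using 2 dual_norm_pos by (intro sum_mono Youngs_inequality) auto
    also have "\<dots> = psum n p x / p + psum n q \<theta> / h powr q / q"
      using dual_norm_pos by (simp add: psum_def sum.distrib powr_divide sum_divide_distrib)
    also have "\<dots> \<le> 1 / p + 1 / q"
      using x 2 h dual_norm_pos by (intro add_mono divide_right_mono) auto
    also have "\<dots> = 1" by fact
    finally show ?thesis using dual_norm_pos by (simp add: field_simps)
  qed
  finally show ?thesis .
qed

text \<open>The equality case of Hoelder: a signed unit vector at a largest coordinate if
  \<open>p = 1\<close>, otherwise entries proportional to
  \<open>\<bar>\<theta> i\<bar> powr (q - 1)\<close> with the sign of \<open>\<theta> i\<close>. The
  maximizer need not be extensional, hence a condition on \<open>psum\<close> in place of membership
  in the ball.\<close>

lemma dual_norm_attained: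
  obtains x where "psum n p x \<le> 1" "inner_n n x \<theta> = h"
proof (cases rule: dual_norm_cases)
  case 1
  have "h \<in> (\<lambda>i. \<bar>\<theta> i\<bar>) ` {..<n}" unfolding 1 using n by (intro Max_in) (auto simp: lessThan_empty_iff)
  then obtain j where j: "j < n" "h = \<bar>\<theta> j\<bar>" by auto
  let ?x = "\<lambda>i. if i = j then sgn (\<theta> j) else 0"
  have "psum n p ?x = (\<Sum>i<n. if i = j then \<bar>sgn (\<theta> j)\<bar> else 0)"
    unfolding psum_def using 1 by (intro sum.cong) auto
  then have "psum n p ?x \<le> 1" using j by (simp add: sgn_if)
  moreover have "inner_n n ?x \<theta> = (\<Sum>i<n. if i = j then sgn (\<theta> j) * \<theta> j else 0)"
    unfolding inner_n_def by (intro sum.cong) auto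
  then have "inner_n n ?x \<theta> = h" using j by (simp add: sgn_mult_self_eq abs_sgn mult.commute)
  ultimately show ?thesis using that by blast
next
  case (2 q)
  have h: "psum n q \<theta> = h powr q" using 2 by (intro psum_\<theta>_eq) auto
  \<comment> \<open>This identity turns the \<open>p\<close>-th powers of the entries of the
    maximizer into \<open>q\<close>-th powers of the entries of \<theta>.\<close>
  have pq: "(q - 1) * p = q" using 2 by (simp add: field_simps)
  define x where "x i = sgn (\<theta> i) * (\<bar>\<theta> i\<bar> / h) powr (q - 1)" for i
  have "\<bar>x i\<bar> powr p = \<bar>\<theta> i\<bar> powr q / h powr q" for i
  proof -
    have "\<bar>x i\<bar> = (\<bar>\<theta> i\<bar> / h) powr (q - 1)" by (auto simp: x_def sgn_if abs_mult)
    then show ?thesis using dual_norm_pos by (simp add: powr_powr pq powr_divide)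
  qed
  then have "psum n p x = psum n q \<theta> / h powr q" by (simp add: psum_def sum_divide_distrib)
  then have "psum n p x \<le> 1" using h by simp
  moreover have "inner_n n x \<theta> = h"
  proof -
    have "x i * \<theta> i = \<bar>\<theta> i\<bar> powr q / h powr (q - 1)" for i
    proof (cases "\<theta> i = 0")
      case False
      have "sgn (\<theta> i) * \<theta> i = \<bar>\<theta> i\<bar>" by (simp add: sgn_if)
      moreover have "x i * \<theta> i = (\<bar>\<theta> i\<bar> / h) powr (q - 1) * (sgn (\<theta> i) * \<theta> i)"
        by (simp add: x_def)
      ultimately have "x i * \<theta> i = (\<bar>\<theta> i\<bar> / h) powr (q - 1) * \<bar>\<theta> i\<bar> powr 1"
        by simp
      also have "\<dots> = \<bar>\<theta> i\<bar> powr (q - 1 + 1) / h powr (q - 1)"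
        unfolding powr_add using dual_norm_pos by (simp add: powr_divide)
      finally show ?thesis by simp
    qed (use 2 in \<open>simp add: x_def\<close>)
    then have "inner_n n x \<theta> = psum n q \<theta> / h powr (q - 1)"
      by (simp add: inner_n_def psum_def sum_divide_distrib)
    also have "\<dots> = h" using h dual_norm_pos by (simp add: powr_diff)
    finally show ?thesis .
  qed
  ultimately show ?thesis using that by blast
qed

text \<open>The number \<open>m\<close> bounds the \<open>p\<close>-norm of the unit vector
  \<theta>, so Hoelder applies to \<theta> divided by \<open>m\<close>, where the functional is
  \<open>1 / m\<close>. The resulting \<open>1 \<le> m * h\<close> controls the quadratic part of
  the exponential moments.\<close>

lemma dual_norm_lower: "1 \<le> real n powr (2 / p - 1) * h\<^sup>2"
proof -
  define m where "m = real n powr (1 / p - 1 / 2)"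
  have "(1 / p - 1 / 2) * p = 1 - p / 2" "(1 / p - 1 / 2) * 2 = 2 / p - 1"
    using p by (simp_all add: left_diff_distrib)
  then have m: "0 < m" "m powr p = real n powr (1 - p / 2)" "m\<^sup>2 = real n powr (2 / p - 1)"
    using n by (simp_all add: m_def powr_powr flip: powr_realpow)
  have "psum n p (\<lambda>i. \<theta> i / m) = psum n p \<theta> / m powr p"
    using m by (simp add: psum_def powr_divide sum_divide_distrib)
  also have "\<dots> \<le> 1"
    using psum_le_square_sum[OF p n, of \<theta>] m n by (simp add: square_sum_\<theta>)
  finally have "\<bar>inner_n n (\<lambda>i. \<theta> i / m) \<theta>\<bar> \<le> h" by (rule holder_ball)
  also have "inner_n n (\<lambda>i. \<theta> i / m) \<theta> = 1 / m"
    using square_sum_\<theta> by (simp add: inner_n_def flip: sum_divide_distrib power2_eq_square)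
  finally have "1 \<le> m * h" using m by (simp add: field_simps)
  then have "1 \<le> (m * h)\<^sup>2" by simp
  then show ?thesis by (simp add: power_mult_distrib m)
qed

text \<open>The parameter \<open>s\<close> at which \<open>y ^ (2 * k) \<le> fact (2 * k) / s ^ (2 * k) * cosh (s * y)\<close> is applied to
  \<open>y = inner_n n x \<theta>\<close>: the largest order of \<open>s\<close> for which the cosh integral stays below \<open>exp (6 * k)\<close>.\<close>

definition moment_scale :: "nat \<Rightarrow> real" where
  "moment_scale k = sqrt k * real n powr (1 / 2 - 1 / p) / (2 * h)"

lemma moment_scale_pos: "1 \<le> k \<Longrightarrow> 0 < moment_scale k"
  using dual_norm_pos n by (simp add: moment_scale_def)

lemma moment_scale_square: "(moment_scale k)\<^sup>2 = k * real n powr (1 - 2 / p) / (4 * h\<^sup>2)"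
proof -
  have "(real n powr (1 / 2 - 1 / p))\<^sup>2 = real n powr (1 - 2 / p)"
    using n by (simp add: powr_powr left_diff_distrib flip: powr_realpow)
  then show ?thesis by (simp add: moment_scale_def power_mult_distrib power_divide)
qed

text \<open>The quadratic exponents sum to \<open>16 * s\<^sup>2 \<le> 4 * k\<close>, because
  \<theta> is a unit vector. For \<open>p > 1\<close> the exponents of order \<open>q\<close> add at
  most \<open>2 * k\<close>, because \<open>h\<close> is the \<open>q\<close>-norm of
  \<theta>.\<close>

lemma prod_mgf_le:
  assumes k: "1 \<le> k" "k \<le> n" and s: "\<bar>s\<bar> = moment_scale k"
  shows "(\<Prod>i<n. \<integral>\<^sup>+ t. ennreal (exp (s * \<theta> i * t) * exp (- (\<bar>t\<bar> powr p))) \<partial>lborel)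
    \<le> ennreal (exp (6 * real k) * exp_powr_mass p ^ n)"
proof -
  have Z: "0 < exp_powr_mass p" using p by (simp add: exp_powr_mass)
  have s2: "16 * s\<^sup>2 \<le> 4 * k"
  proof -
    have "real n powr (1 - 2 / p) \<le> real n powr (1 - 2 / p) * (real n powr (2 / p - 1) * h\<^sup>2)"
      using mult_left_mono[OF dual_norm_lower, of "real n powr (1 - 2 / p)"] by simp
    also have "\<dots> = h\<^sup>2" using n by (simp flip: powr_add mult.assoc)
    finally have "real n powr (1 - 2 / p) / h\<^sup>2 \<le> 1" using dual_norm_pos by simp
    then have "real k * (real n powr (1 - 2 / p) / h\<^sup>2) \<le> real k * 1" by (intro mult_left_mono) auto
    moreover have "s\<^sup>2 = k * real n powr (1 - 2 / p) / (4 * h\<^sup>2)"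
      using s by (metis moment_scale_square power2_abs)
    ultimately show ?thesis by simp
  qed
  \<comment> \<open>Here \<open>e i\<close> is the extra exponent of coordinate \<open>i\<close>: it
    is 0 if \<open>p = 1\<close>, where every \<open>\<bar>s * \<theta> i\<bar>\<close> is at most
    \<open>1 / 2\<close>, and the exponent of the large-parameter bound if
    \<open>p > 1\<close>.\<close>
  have "\<exists>e. (\<Sum>i<n. e i) \<le> 2 * real k \<and> (\<forall>i<n.
     (\<integral>\<^sup>+ t. ennreal (exp (s * \<theta> i * t) * exp (- (\<bar>t\<bar> powr p))) \<partial>lborel)
       \<le> ennreal (exp (16 * (s * \<theta> i)\<^sup>2 + e i) * exp_powr_mass p))"
  proof (cases rule: dual_norm_cases)
    case 1
    have root: "sqrt k * real n powr (- (1 / 2)) = sqrt (k / n)"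
      using n by (simp add: powr_minus_divide powr_half_sqrt real_sqrt_divide)
    have "\<bar>s * \<theta> i\<bar> \<le> 1 / 2" if "i < n" for i
    proof -
      have "\<bar>s\<bar> * \<bar>\<theta> i\<bar> \<le> \<bar>s\<bar> * h" using that 1 by (intro mult_left_mono abs_\<theta>_le) auto
      also have "\<dots> = sqrt k * real n powr (- (1 / 2)) / 2"
        unfolding s moment_scale_def using dual_norm_pos by (simp add: 1(1))
      also have "\<dots> = sqrt (k / n) / 2" unfolding root ..
      also have "\<dots> \<le> 1 / 2" using k n by simp
      finally show ?thesis by (simp add: abs_mult)
    qed
    then show ?thesis using p by (intro exI[of _ "\<lambda>_. 0"]) (auto intro!: nn_integral_exp_powr_mgf_small)
  next
    case (2 q)
    have h: "psum n q \<theta> = h powr q" using 2 by (intro psum_\<theta>_eq) auto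
    have "(\<Sum>i<n. 2 * (2 * \<bar>s * \<theta> i\<bar>) powr q) = 2 * (2 * \<bar>s\<bar> * h) powr q"
      using h dual_norm_pos by (simp add: psum_def abs_mult powr_mult flip: sum_distrib_left)
    also have "2 * \<bar>s\<bar> * h = sqrt k * real n powr (1 / 2 - 1 / p)"
      using dual_norm_pos s by (simp add: moment_scale_def)
    also have "\<dots> powr q = real k powr (q / 2) * real n powr ((1 / 2 - 1 / p) * q)"
      using k n by (simp add: powr_mult powr_powr flip: powr_half_sqrt)
    also have "(1 / 2 - 1 / p) * q = - (q / 2 - 1)" using 2 by (simp add: field_simps)
    also have "real k powr (q / 2) = real k * real k powr (q / 2 - 1)"
      using k by (simp add: powr_diff)
    also have "real k * real k powr (q / 2 - 1) * real n powr (- (q / 2 - 1)) = k * (real k / real n) powr (q / 2 - 1)"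
      using k n by (simp add: powr_minus powr_divide field_simps)
    \<comment> \<open>Both \<open>k \<le> n\<close> and \<open>2 \<le> q\<close> enter here.\<close>
    also have "\<dots> \<le> real k * 1" using k n 2 by (intro mult_left_mono powr_le1) auto
    finally have sum: "(\<Sum>i<n. 2 * (2 * \<bar>s * \<theta> i\<bar>) powr q) \<le> 2 * real k" by simp
    have "(\<integral>\<^sup>+ t. ennreal (exp (s * \<theta> i * t) * exp (- (\<bar>t\<bar> powr p))) \<partial>lborel)
       \<le> ennreal (exp (16 * (s * \<theta> i)\<^sup>2 + 2 * (2 * \<bar>s * \<theta> i\<bar>) powr q) * exp_powr_mass p)" for i
    \<comment> \<open>Either one-dimensional bound lies below the one with the summed exponents, so
      small and large coordinates can be added together.\<close>
    proof (cases "\<bar>s * \<theta> i\<bar> \<le> 1 / 2")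
      case True
      show ?thesis
        by (rule order.trans[OF nn_integral_exp_powr_mgf_small[OF p(1) True]])
          (use Z in \<open>intro ennreal_leI mult_right_mono; simp\<close>)
    next
      case False
      then have "1 / 2 \<le> \<bar>s * \<theta> i\<bar>" by simp
      show ?thesis
        by (rule order.trans[OF nn_integral_exp_powr_mgf_large[OF 2(1,3) \<open>1 / 2 \<le> \<bar>s * \<theta> i\<bar>\<close>]])
          (use Z in \<open>intro ennreal_leI mult_right_mono; simp\<close>)
    qed
    then show ?thesis using sum by (intro exI[of _ "\<lambda>i. 2 * (2 * \<bar>s * \<theta> i\<bar>) powr q"]) auto
  qed
  then obtain e where e: "(\<Sum>i<n. e i) \<le> 2 * real k"
    and le: "\<And>i. i < n \<Longrightarrow> (\<integral>\<^sup>+ t. ennreal (exp (s * \<theta> i * t) * exp (- (\<bar>t\<bar> powr p))) \<partial>lborel)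
       \<le> ennreal (exp (16 * (s * \<theta> i)\<^sup>2 + e i) * exp_powr_mass p)" by blast
  have "(\<Prod>i<n. \<integral>\<^sup>+ t. ennreal (exp (s * \<theta> i * t) * exp (- (\<bar>t\<bar> powr p))) \<partial>lborel)
    \<le> (\<Prod>i<n. ennreal (exp (16 * (s * \<theta> i)\<^sup>2 + e i) * exp_powr_mass p))"
    using le by (intro prod_mono_ennreal) auto
  also have "\<dots> = ennreal (exp (16 * s\<^sup>2 * (\<Sum>i<n. (\<theta> i)\<^sup>2) + (\<Sum>i<n. e i)) * exp_powr_mass p ^ n)"
    using Z by (simp add: prod_ennreal prod.distrib exp_sum sum.distrib sum_distrib_left power_mult_distrib exp_add mult.assoc)
  also have "\<dots> \<le> ennreal (exp (6 * real k) * exp_powr_mass p ^ n)"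
    using s2 e Z by (intro ennreal_leI mult_right_mono) (auto simp: square_sum_\<theta>)
  finally show ?thesis .
qed

end

section \<open>Moments and the Orlicz norm\<close>

lemma lp_ball_sets: "0 < p \<Longrightarrow> lp_ball n (ennreal p) \<in> sets (lebesgue_n n)"
  unfolding lp_ball_eq by measurable

lemma exp_psum_prod: "exp (- psum n p x) = (\<Prod>i<n. exp (- (\<bar>x i\<bar> powr p)))"
  by (simp add: psum_def exp_sum flip: sum_negf)

section \<open>Volume of the ball and integrals over it\<close>

text \<open>The homogeneity formula for the constant 1, of degree 0; the weighted integral
  factorises over the coordinates.\<close>

lemma emeasure_lp_ball:
  assumes p: "1 \<le> p"
  shows "emeasure (lebesgue_n n) (lp_ball n (ennreal p)) =
    ennreal (exp_powr_mass p ^ n / Gamma (real n / p + 1))"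
proof -
  let ?V = "emeasure (lebesgue_n n) (lp_ball n (ennreal p))"
  let ?G = "Gamma (real n / p + 1)" and ?Z = "exp_powr_mass p ^ n"
  have G: "0 < ?G" using p by (intro Gamma_real_pos) (simp add: add_nonneg_pos)
  have Z: "0 < ?Z" using exp_powr_mass(2)[OF p] by simp
  have "(\<integral>\<^sup>+ x. ennreal (1 * exp (- psum n p x)) \<partial>lebesgue_n n) =
    ennreal (Gamma (real (n + 0) / p + 1)) * (\<integral>\<^sup>+ x. ennreal 1 * indicator (lp_ball n (ennreal p)) x \<partial>lebesgue_n n)"
    using p by (intro nn_integral_homogeneous_exp) auto
  moreover have "(\<integral>\<^sup>+ x. ennreal (1 * exp (- psum n p x)) \<partial>lebesgue_n n)
      = (\<integral>\<^sup>+ x. (\<Prod>i<n. ennreal (exp (- (\<bar>x i\<bar> powr p)))) \<partial>lebesgue_n n)"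
    by (simp add: exp_psum_prod prod_ennreal)
  moreover have "\<dots> = (\<Prod>i<n. \<integral>\<^sup>+ t. ennreal (exp (- (\<bar>t\<bar> powr p))) \<partial>lborel)"
    by (rule nn_integral_lebesgue_n_prod) measurable
  moreover have "\<dots> = ennreal ?Z"
    using exp_powr_mass[OF p] by (simp add: ennreal_power)
  ultimately have eq: "ennreal ?Z = ennreal ?G * ?V"
    using p lp_ball_sets[of p n] by simp
  show ?thesis
  proof (cases ?V)
    case (real v)
    then have "?Z = ?G * v" using eq G Z by (simp flip: ennreal_mult)
    then show ?thesis using G real by simp
  next
    case top
    then show ?thesis using eq G by (simp add: ennreal_mult_top)
  qed
qed

definition ball_volume :: "nat \<Rightarrow> real \<Rightarrow> real" where
  "ball_volume n p = exp_powr_mass p ^ n / Gamma (real n / p + 1)"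

lemma ball_volume_pos: "1 \<le> p \<Longrightarrow> 0 < ball_volume n p"
  unfolding ball_volume_def
  by (intro divide_pos_pos zero_less_power exp_powr_mass Gamma_real_pos) (auto simp: add_nonneg_pos)

text \<open>Divide the homogeneity formula by its Gamma factor; \<open>Gamma_shift_ge\<close> with
  \<open>a = n / p\<close> and \<open>b = q / p\<close> leaves the volume times a power of
  \<open>p / n\<close>.\<close>

lemma ball_integral_le:
  fixes F :: "(nat \<Rightarrow> real) \<Rightarrow> real"
  assumes p: "1 \<le> p" and n: "1 \<le> n" and F: "F \<in> borel_measurable (lebesgue_n n)"
    and F0: "\<And>x. 0 \<le> F x"
    and hom: "\<And>c x. 0 < c \<Longrightarrow> F (\<lambda>i\<in>{..<n}. c * x i) = c ^ q * F x"
    and le: "(\<integral>\<^sup>+ x. ennreal (F x * exp (- psum n p x)) \<partial>lebesgue_n n) \<le> ennreal (K * exp_powr_mass p ^ n)"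
    and K: "0 \<le> K"
  shows "(\<integral>\<^sup>+ x. ennreal (F x) * indicator (lp_ball n (ennreal p)) x \<partial>lebesgue_n n)
    \<le> ennreal (K * (p / n) powr (q / p) * ball_volume n p)"
proof -
  let ?I = "\<integral>\<^sup>+ x. ennreal (F x) * indicator (lp_ball n (ennreal p)) x \<partial>lebesgue_n n"
  let ?G = "Gamma (real n / p + 1)" and ?G' = "Gamma (real (n + q) / p + 1)" and ?Z = "exp_powr_mass p ^ n"
  have G: "0 < ?G" using p by (intro Gamma_real_pos) (simp add: add_nonneg_pos)
  have G': "0 < ?G'" using p by (intro Gamma_real_pos) (simp add: add_nonneg_pos)
  have Z: "0 < ?Z" using exp_powr_mass(2)[OF p] by simp
  have I: "ennreal ?G' * ?I \<le> ennreal (K * ?Z)"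
    using nn_integral_homogeneous_exp[of p F n q] assms by simp
  show ?thesis
  proof (cases ?I)
    case (real r)
    then have "?G' * r \<le> K * ?Z" using I G' Z K by (simp flip: ennreal_mult)
    moreover have "(real n / p) powr (q / p) * ?G \<le> ?G'"
      using Gamma_shift_ge[of "real n / p" "q / p"] n p by (simp add: add_divide_distrib add_ac)
    then have "(real n / p) powr (q / p) * ?G * r \<le> ?G' * r" using real by (intro mult_right_mono) auto
    ultimately have "(real n / p) powr (q / p) * ?G * r \<le> K * ?Z" by linarith
    then have "r \<le> K * ?Z / ((real n / p) powr (q / p) * ?G)"
      using G n p by (simp add: pos_le_divide_eq ac_simps)
    also have "\<dots> = K * (p / n) powr (q / p) * ball_volume n p"
      using n p by (simp add: ball_volume_def powr_divide field_simps)
    finally show ?thesis using real by (simp add: ennreal_leI)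
  next
    case top
    then show ?thesis using I G' by (simp add: ennreal_mult_top top_unique)
  qed
qed

lemma power_self_le_fact: "real k ^ k \<le> fact k * exp k"
proof -
  have "(\<Sum>n\<in>{k}. real k ^ n /\<^sub>R fact n) \<le> exp (real k)"
    unfolding exp_def by (intro sum_le_suminf summable_exp_generic) auto
  then show ?thesis by (simp add: field_simps)
qed

lemma fact_double_le: "(fact (2 * k) :: real) \<le> (4 * real k ^ 2) ^ k"
proof -
  have "(fact (2 * k) :: real) \<le> real (2 * k) ^ (2 * k)"
    using fact_le_power[of "2 * k", where ?'a=real] by simp
  also have "\<dots> = (4 * real k ^ 2) ^ k" by (simp add: power_mult power_mult_distrib)
  finally show ?thesis .
qed

lemma powr_self_inverse_le:
  fixes p :: real
  assumes "1 \<le> p" "p \<le> 2"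
  shows "p powr (2 / p) \<le> 4"
proof -
  have "p powr (2 / p) \<le> p powr 2" using assms by (intro powr_mono) (auto simp: field_simps)
  also have "\<dots> \<le> 2 powr 2" using assms by (intro powr_mono2) auto
  finally show ?thesis by simp
qed

lemma powr_two_over:
  assumes "1 \<le> p" "1 \<le> n"
  shows "(p / real n) powr (2 / p) = p powr (2 / p) * real n powr (- (2 / p))"
  using assms by (simp add: powr_divide powr_minus_divide)

lemma inner_n_dilate: "inner_n n (\<lambda>i\<in>{..<n}. c * x i) \<theta> = c * inner_n n x \<theta>"
  by (simp add: inner_n_def sum_distrib_left ac_simps)

section \<open>Even moments of the functional\<close>

context dual_direction
begin

abbreviation "B \<equiv> lp_ball n (ennreal p)"
abbreviation "L \<equiv> lebesgue_n n"
abbreviation "vol \<equiv> ball_volume n p"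
abbreviation "f \<equiv> \<lambda>x. inner_n n x \<theta>"
text \<open>Here \<open>64 = 4 * 16\<close>, with 4 from \<open>fact_double_le\<close> and 16 from
  \<open>moment_scale_square\<close> and \<open>powr_self_inverse_le\<close>; \<open>exp 7\<close>
  joins \<open>exp 6\<close> from \<open>prod_mgf_le\<close> and \<open>exp 1\<close> from
  \<open>power_self_le_fact\<close>.\<close>

abbreviation "M \<equiv> 64 * exp 7 :: real"

lemma B_sets [measurable]: "B \<in> sets L"
  using p by (intro lp_ball_sets) simp

lemma emeasure_B: "emeasure L B = ennreal vol"
  using p by (simp add: emeasure_lp_ball ball_volume_def)

lemma vol_pos: "0 < vol"
  using p by (simp add: ball_volume_pos)

lemma mem_B: "x \<in> B \<longleftrightarrow> x \<in> space L \<and> psum n p x \<le> 1"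
  using p by (simp add: lp_ball_eq)

lemma even_moment_exp_le:
  assumes k: "1 \<le> k" "k \<le> n"
  shows "(\<integral>\<^sup>+ x. ennreal (f x ^ (2 * k) * exp (- psum n p x)) \<partial>L)
    \<le> ennreal (fact (2 * k) / moment_scale k ^ (2 * k) * exp (6 * real k) * exp_powr_mass p ^ n)"
proof -
  let ?s = "moment_scale k"
  let ?a = "fact (2 * k) / ?s ^ (2 * k)"
  have s: "0 < ?s" using k by (intro moment_scale_pos)
  have Z: "0 < exp_powr_mass p" using p by (simp add: exp_powr_mass)
  \<comment> \<open>The same function is needed as a product, for Fubini, and as an exponential of
    the functional.\<close>
  define P where "P u x = (\<Prod>i<n. ennreal (exp (u * \<theta> i * x i) * exp (- (\<bar>x i\<bar> powr p))))" for u and x :: "nat \<Rightarrow> real"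
  have P: "P u x = ennreal (exp (u * f x) * exp (- psum n p x))" for u x
    by (simp add: P_def prod_ennreal prod.distrib exp_psum_prod inner_n_def sum_distrib_left exp_sum ac_simps)
  have P_measurable [measurable]: "P u \<in> borel_measurable L" for u
    unfolding P by measurable
  have int: "(\<integral>\<^sup>+ x. P u x \<partial>L) \<le> ennreal (exp (6 * real k) * exp_powr_mass p ^ n)" if "\<bar>u\<bar> = ?s" for u
  proof -
    have "(\<integral>\<^sup>+ x. P u x \<partial>L) = (\<Prod>i<n. \<integral>\<^sup>+ t. ennreal (exp (u * \<theta> i * t) * exp (- (\<bar>t\<bar> powr p))) \<partial>lborel)"
      unfolding P_def by (rule nn_integral_lebesgue_n_prod) measurable
    then show ?thesis using prod_mgf_le[OF k that] by simp
  qed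
  have "(\<integral>\<^sup>+ x. ennreal (f x ^ (2 * k) * exp (- psum n p x)) \<partial>L)
     \<le> (\<integral>\<^sup>+ x. ennreal (?a / 2) * (P ?s x + P (- ?s) x) \<partial>L)"
  proof (rule nn_integral_mono)
    fix x
    have "f x ^ (2 * k) = (?s * f x) ^ (2 * k) / ?s ^ (2 * k)"
      using s by (simp add: power_mult_distrib)
    also have "\<dots> \<le> fact (2 * k) * cosh (?s * f x) / ?s ^ (2 * k)"
      using s by (intro divide_right_mono power_even_le_cosh) auto
    also have "\<dots> = ?a / 2 * (exp (?s * f x) + exp (- ?s * f x))"
      by (simp add: cosh_def)
    finally have "f x ^ (2 * k) * exp (- psum n p x) \<le> ?a / 2 * (exp (?s * f x) + exp (- ?s * f x)) * exp (- psum n p x)"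
      by (rule mult_right_mono) simp
    also have "\<dots> = ?a / 2 * (exp (?s * f x) * exp (- psum n p x) + exp (- ?s * f x) * exp (- psum n p x))"
      by (simp only: distrib_right mult.assoc)
    finally have "ennreal (f x ^ (2 * k) * exp (- psum n p x)) \<le>
      ennreal (?a / 2 * (exp (?s * f x) * exp (- psum n p x) + exp (- ?s * f x) * exp (- psum n p x)))"
      by (rule ennreal_leI)
    also have "\<dots> = ennreal (?a / 2) * (P ?s x + P (- ?s) x)"
      unfolding P using s by (subst ennreal_mult) (auto simp: ennreal_plus)
    finally show "ennreal (f x ^ (2 * k) * exp (- psum n p x)) \<le> ennreal (?a / 2) * (P ?s x + P (- ?s) x)" .
  qed
  also have "\<dots> = ennreal (?a / 2) * ((\<integral>\<^sup>+ x. P ?s x \<partial>L) + (\<integral>\<^sup>+ x. P (- ?s) x \<partial>L))"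
    by (simp add: nn_integral_cmult nn_integral_add)
  also have "\<dots> \<le> ennreal (?a / 2) * (ennreal (exp (6 * real k) * exp_powr_mass p ^ n) + ennreal (exp (6 * real k) * exp_powr_mass p ^ n))"
    using s by (intro mult_left_mono add_mono int) auto
  also have "\<dots> = ennreal (?a / 2 * (exp (6 * real k) * exp_powr_mass p ^ n + exp (6 * real k) * exp_powr_mass p ^ n))"
    using s Z by (simp flip: ennreal_plus ennreal_mult)
  also have "?a / 2 * (exp (6 * real k) * exp_powr_mass p ^ n + exp (6 * real k) * exp_powr_mass p ^ n)
     = ?a * exp (6 * real k) * exp_powr_mass p ^ n" by (simp add: mult.assoc)
  finally show ?thesis .
qed

text \<open>All factors except the factorial are \<open>k\<close>-th powers, and the powers of
  \<open>n\<close> in them combine to \<open>1 / n\<close>. After \<open>fact_double_le\<close> one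
  factor \<open>k\<close> is left in the base, and \<open>k ^ k\<close> is traded for
  \<open>fact k * exp k\<close>.\<close>

lemma even_moment_constant_le:
  assumes k: "1 \<le> k"
  shows "fact (2 * k) / moment_scale k ^ (2 * k) * exp (6 * real k) * (p / n) powr (real (2 * k) / p)
    \<le> fact k * (M * h\<^sup>2 / n) ^ k"
proof -
  let ?r = "(p / n) powr (2 / p) / (moment_scale k)\<^sup>2"
  have h: "0 < h" by (rule dual_norm_pos)
  have r: "?r \<le> 16 * h\<^sup>2 / (k * n)"
  proof -
    have e: "real n powr (- (2 / p)) / real n powr (1 - 2 / p) = 1 / n"
      unfolding powr_diff[symmetric] using n by (simp add: powr_minus_divide)
    have "?r = p powr (2 / p) * (4 * h\<^sup>2 / k) * (real n powr (- (2 / p)) / real n powr (1 - 2 / p))"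
      using p n by (simp add: powr_two_over moment_scale_square)
    also have "\<dots> = p powr (2 / p) * (4 * h\<^sup>2 / (k * n))"
      unfolding e by simp
    also have "\<dots> \<le> 4 * (4 * h\<^sup>2 / (k * n))"
      using powr_self_inverse_le[OF p] by (intro mult_right_mono) auto
    finally show ?thesis by simp
  qed
  have "(p / n) powr (real (2 * k) / p) = ((p / n) powr (2 / p)) ^ k"
    using p n by (simp add: powr_powr flip: powr_realpow)
  moreover have "exp (6 * real k) = exp 6 ^ k" by (simp add: mult.commute flip: exp_of_nat_mult)
  ultimately have "fact (2 * k) / moment_scale k ^ (2 * k) * exp (6 * real k) * (p / n) powr (real (2 * k) / p)
     = fact (2 * k) * (exp 6 * ?r) ^ k"
    by (simp add: power_mult power_mult_distrib power_divide)
  also have "\<dots> \<le> (4 * real k ^ 2) ^ k * (exp 6 * (16 * h\<^sup>2 / (k * n))) ^ k"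
    using r by (intro mult_mono fact_double_le power_mono mult_left_mono) auto
  also have "\<dots> = (real k * (64 * exp 6 * h\<^sup>2 / n)) ^ k"
  proof -
    have "4 * real k ^ 2 * (exp 6 * (16 * h\<^sup>2 / (k * n))) = real k * (64 * exp 6 * h\<^sup>2 / n)"
      using k by (simp add: power2_eq_square)
    then show ?thesis unfolding power_mult_distrib[symmetric] by (rule arg_cong)
  qed
  also have "\<dots> = real k ^ k * (64 * exp 6 * h\<^sup>2 / n) ^ k"
    by (rule power_mult_distrib)
  also have "\<dots> \<le> (fact k * exp k) * (64 * exp 6 * h\<^sup>2 / n) ^ k"
    by (intro mult_right_mono power_self_le_fact) auto
  also have "exp (real k) = exp 1 ^ k" by (simp flip: exp_of_nat_mult)
  also have "fact k * exp 1 ^ k * (64 * exp 6 * h\<^sup>2 / n) ^ k = fact k * (64 * (exp 1 * exp 6) * h\<^sup>2 / n) ^ k"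
    by (simp add: power_mult_distrib power_divide)
  also have "exp 1 * exp 6 = (exp 7 :: real)" by (simp flip: exp_add)
  finally show ?thesis .
qed

lemma even_moment_le:
  "(\<integral>\<^sup>+ x. ennreal (f x ^ (2 * k)) * indicator B x \<partial>L) \<le> ennreal (fact k * (M * h\<^sup>2 / n) ^ k * vol)"
proof -
  \<comment> \<open>The exponential integrals serve for \<open>1 \<le> k \<le> n\<close>. Beyond
    that \<open>\<bar>f x\<bar> \<le> h\<close> is enough, because then
    \<open>h\<^sup>2 \<le> k * (h\<^sup>2 / n)\<close>. For \<open>k = 0\<close> the scale vanishes,
    but the integral is just the volume.\<close>
  consider "k = 0" | "1 \<le> k" "k \<le> n" | "n < k" by linarith
  then show ?thesis
  proof cases
    case 1
    then show ?thesis by (simp add: emeasure_B)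
  next
    case 2
    let ?K = "fact (2 * k) / moment_scale k ^ (2 * k) * exp (6 * real k)"
    have "(\<integral>\<^sup>+ x. ennreal (f x ^ (2 * k)) * indicator B x \<partial>L)
       \<le> ennreal (?K * (p / n) powr (real (2 * k) / p) * vol)"
    proof (rule ball_integral_le)
      show "f (\<lambda>i\<in>{..<n}. c * x i) ^ (2 * k) = c ^ (2 * k) * f x ^ (2 * k)" for c x
        by (simp add: inner_n_dilate power_mult_distrib)
      show "(\<integral>\<^sup>+ x. ennreal (f x ^ (2 * k) * exp (- psum n p x)) \<partial>L) \<le> ennreal (?K * exp_powr_mass p ^ n)"
        using 2 by (rule even_moment_exp_le)
      show "0 \<le> ?K" using moment_scale_pos[of k] 2 by simp
    qed (use p n in \<open>auto simp: zero_le_even_power\<close>)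
    also have "\<dots> \<le> ennreal (fact k * (M * h\<^sup>2 / n) ^ k * vol)"
      using even_moment_constant_le[of k] 2 vol_pos by (intro ennreal_leI mult_right_mono) auto
    finally show ?thesis .
  next
    case 3
    have h: "0 < h" by (rule dual_norm_pos)
    have "(\<integral>\<^sup>+ x. ennreal (f x ^ (2 * k)) * indicator B x \<partial>L) \<le> (\<integral>\<^sup>+ x. ennreal ((h\<^sup>2) ^ k) * indicator B x \<partial>L)"
    proof (rule nn_integral_mono)
      fix x
      have "f x ^ (2 * k) \<le> (h\<^sup>2) ^ k" if "x \<in> B"
      proof -
        have "\<bar>f x\<bar> \<le> \<bar>h\<bar>" using holder_ball[of x] that by (simp add: mem_B)
        then have "(f x)\<^sup>2 \<le> h\<^sup>2" by (simp only: abs_le_square_iff)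
        then show ?thesis unfolding power_mult by (rule power_mono) simp
      qed
      then show "ennreal (f x ^ (2 * k)) * indicator B x \<le> ennreal ((h\<^sup>2) ^ k) * indicator B x"
        by (auto simp: indicator_def intro!: ennreal_leI)
    qed
    also have "\<dots> = ennreal ((h\<^sup>2) ^ k * vol)"
      using vol_pos by (simp add: nn_integral_cmult_indicator emeasure_B ennreal_mult)
    also have "(h\<^sup>2) ^ k \<le> fact k * (M * h\<^sup>2 / n) ^ k"
    proof -
      have "(h\<^sup>2) ^ k \<le> (real k * (h\<^sup>2 / n)) ^ k"
      proof (rule power_mono)
        show "h\<^sup>2 \<le> real k * (h\<^sup>2 / n)" using 3 n h by (simp add: field_simps mult_left_mono)
      qed simp
      also have "\<dots> = real k ^ k * (h\<^sup>2 / n) ^ k" by (rule power_mult_distrib)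
      also have "\<dots> \<le> (fact k * exp k) * (h\<^sup>2 / n) ^ k"
        by (intro mult_right_mono power_self_le_fact) auto
      also have "\<dots> = fact k * (exp 1 * (h\<^sup>2 / n)) ^ k"
      proof -
        have "exp (real k) = exp 1 ^ k" by (simp flip: exp_of_nat_mult)
        then show ?thesis unfolding power_mult_distrib by (simp only: mult.assoc)
      qed
      also have "\<dots> \<le> fact k * (M * (h\<^sup>2 / n)) ^ k"
      proof (intro mult_left_mono power_mono mult_right_mono)
        have "exp 1 \<le> (exp 7 :: real)" by simp
        moreover have "0 < (exp 7 :: real)" by simp
        ultimately show "exp 1 \<le> M" by linarith
      qed auto
      finally show ?thesis by simp
    qed
    finally show ?thesis using vol_pos by (simp add: mult_right_mono ennreal_leI)
  qed
qed

section \<open>Bounds for the Orlicz norm\<close>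

abbreviation "\<mu> \<equiv> uniform_measure L B"

text \<open>Expand the exponential and integrate term by term. The \<open>fact k\<close> of the
  moment bound cancels against the series, and the 2 under the root of \<open>?t\<close> makes the
  \<open>k\<close>-th term at most \<open>(1 / 2) ^ k\<close> times the volume, so the sum is at
  most twice the volume.\<close>

lemma psi2_norm_le: "psi2_norm \<mu> f \<le> ennreal (sqrt (2 * M) * h / sqrt n)"
proof -
  let ?t = "sqrt (2 * M) * h / sqrt n"
  have h: "0 < h" by (rule dual_norm_pos)
  have t: "0 < ?t" using h n by simp
  have t2: "?t\<^sup>2 = 2 * (M * h\<^sup>2 / n)" using n by (simp add: power_mult_distrib power_divide)
  have cancel: "1 / (a ^ (2 * k) * fact k) * (fact k * b ^ k * c) = (b / a\<^sup>2) ^ k * c" for a b c :: real and k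
    by (simp add: power_mult power_divide)
  have "(\<integral>\<^sup>+ x. ennreal (exp (\<bar>f x / ?t\<bar>\<^sup>2)) * indicator B x \<partial>L) =
     (\<integral>\<^sup>+ x. (\<Sum>k. ennreal (1 / (?t ^ (2 * k) * fact k)) * (ennreal (f x ^ (2 * k)) * indicator B x)) \<partial>L)"
  proof (rule nn_integral_cong)
    fix x
    have "(\<lambda>k. (\<bar>f x / ?t\<bar>\<^sup>2) ^ k /\<^sub>R fact k) sums exp (\<bar>f x / ?t\<bar>\<^sup>2)"
      by (rule exp_converges)
    then have "(\<Sum>k. ennreal ((\<bar>f x / ?t\<bar>\<^sup>2) ^ k /\<^sub>R fact k)) = ennreal (exp (\<bar>f x / ?t\<bar>\<^sup>2))"
      by (intro suminf_ennreal_eq) auto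
    moreover have "ennreal ((\<bar>f x / ?t\<bar>\<^sup>2) ^ k /\<^sub>R fact k) = ennreal (1 / (?t ^ (2 * k) * fact k)) * ennreal (f x ^ (2 * k))" for k
    proof -
      have "(\<bar>f x / ?t\<bar>\<^sup>2) ^ k /\<^sub>R fact k = 1 / (?t ^ (2 * k) * fact k) * f x ^ (2 * k)"
        by (simp only: power2_abs power_mult[symmetric] power_divide) (simp add: field_simps)
      then show ?thesis using t by (simp add: zero_le_even_power flip: ennreal_mult)
    qed
    ultimately have "ennreal (exp (\<bar>f x / ?t\<bar>\<^sup>2)) = (\<Sum>k. ennreal (1 / (?t ^ (2 * k) * fact k)) * ennreal (f x ^ (2 * k)))"
      by simp
    then show "ennreal (exp (\<bar>f x / ?t\<bar>\<^sup>2)) * indicator B x =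
      (\<Sum>k. ennreal (1 / (?t ^ (2 * k) * fact k)) * (ennreal (f x ^ (2 * k)) * indicator B x))"
      by (cases "x \<in> B") auto
  qed
  also have "\<dots> = (\<Sum>k. \<integral>\<^sup>+ x. ennreal (1 / (?t ^ (2 * k) * fact k)) * (ennreal (f x ^ (2 * k)) * indicator B x) \<partial>L)"
    by (rule nn_integral_suminf) measurable
  also have "\<dots> \<le> (\<Sum>k. ennreal ((1 / 2) ^ k * vol))"
  proof (rule suminf_le)
    fix k
    have "(\<integral>\<^sup>+ x. ennreal (1 / (?t ^ (2 * k) * fact k)) * (ennreal (f x ^ (2 * k)) * indicator B x) \<partial>L)
       = ennreal (1 / (?t ^ (2 * k) * fact k)) * (\<integral>\<^sup>+ x. (ennreal (f x ^ (2 * k)) * indicator B x) \<partial>L)"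
      by (rule nn_integral_cmult) measurable
    also have "\<dots> \<le> ennreal (1 / (?t ^ (2 * k) * fact k)) * ennreal (fact k * (M * h\<^sup>2 / n) ^ k * vol)"
      by (intro mult_left_mono even_moment_le) auto
    also have "\<dots> = ennreal (1 / (?t ^ (2 * k) * fact k) * (fact k * (M * h\<^sup>2 / n) ^ k * vol))"
      using t vol_pos by (intro ennreal_mult[symmetric]) auto
    also have "1 / (?t ^ (2 * k) * fact k) * (fact k * (M * h\<^sup>2 / n) ^ k * vol) = ((M * h\<^sup>2 / n) / ?t\<^sup>2) ^ k * vol"
      by (rule cancel)
    also have "(M * h\<^sup>2 / n) / ?t\<^sup>2 = 1 / 2"
      unfolding t2 using h n by simp
    finally show "(\<integral>\<^sup>+ x. ennreal (1 / (?t ^ (2 * k) * fact k)) * (ennreal (f x ^ (2 * k)) * indicator B x) \<partial>L)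
      \<le> ennreal ((1 / 2) ^ k * vol)" .
  qed auto
  also have "\<dots> = ennreal (2 * vol)"
  proof (rule suminf_ennreal_eq)
    show "(\<lambda>k. (1 / 2) ^ k * vol) sums (2 * vol)"
      using sums_mult2[OF geometric_sums[of "1 / 2 :: real"], of vol] by simp
  qed (use vol_pos in auto)
  finally have le: "(\<integral>\<^sup>+ x. ennreal (exp (\<bar>f x / ?t\<bar>\<^sup>2)) * indicator B x \<partial>L) \<le> ennreal (2 * vol)" .
  have "(\<integral>\<^sup>+ x. ennreal (exp (\<bar>f x / ?t\<bar>\<^sup>2)) \<partial>\<mu>) =
      (\<integral>\<^sup>+ x. ennreal (exp (\<bar>f x / ?t\<bar>\<^sup>2)) * indicator B x \<partial>L) / ennreal vol"
    by (subst nn_integral_uniform_measure) (auto simp: emeasure_B)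
  also have "\<dots> \<le> ennreal (2 * vol) / ennreal vol"
    by (rule divide_right_mono_ennreal) (rule le)
  also have "\<dots> = 2" using vol_pos by (simp add: divide_ennreal)
  finally show ?thesis unfolding psi2_norm_def using t by (intro Inf_lower) blast
qed

text \<open>If \<open>x\<^sub>0\<close> in the ball attains the dual norm, the functional is at least \<open>h / 3\<close> on the copy
  \<open>2 / 3 * x\<^sub>0 + 1 / 3 * B\<close> of the ball, which occupies the fraction \<open>1 / 3 ^ n\<close> of its volume.\<close>

lemma psi2_admissible_ge:
  assumes t: "0 < t" and adm: "(\<integral>\<^sup>+ x. ennreal (exp (\<bar>f x / t\<bar>\<^sup>2)) \<partial>\<mu>) \<le> 2"
  shows "h / (6 * sqrt n) \<le> t"
proof -
  have h: "0 < h" by (rule dual_norm_pos)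
  obtain x0 where x0: "psum n p x0 \<le> 1" "f x0 = h" by (rule dual_norm_attained)
  let ?T = "\<lambda>y. \<lambda>i\<in>{..<n}. 2 / 3 * x0 i + 1 / 3 * y i"
  let ?E = "exp ((h / (3 * t))\<^sup>2)"
  \<comment> \<open>The left side is the integral of the constant \<open>?E\<close> over the small
    copy of the ball; \<open>(1 / 3) ^ n\<close> is the Jacobian of \<open>?T\<close>.\<close>
  have "ennreal ((1 / 3) ^ n * (?E * vol)) = (\<Prod>i<n. ennreal \<bar>1 / 3\<bar>) * (\<integral>\<^sup>+ y. ennreal ?E * indicator B y \<partial>L)"
    using vol_pos by (simp add: nn_integral_cmult_indicator emeasure_B ennreal_mult ennreal_power)
  also have "\<dots> \<le> (\<Prod>i<n. ennreal \<bar>1 / 3\<bar>) * (\<integral>\<^sup>+ y. ennreal (exp (\<bar>f (?T y) / t\<bar>\<^sup>2)) * indicator B (?T y) \<partial>L)"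
  proof (intro mult_left_mono nn_integral_mono)
    fix y
    have "?T y \<in> B \<and> h / 3 \<le> f (?T y)" if y: "y \<in> B"
    proof
      have "psum n p (?T y) \<le> 2 / 3 * psum n p x0 + 1 / 3 * psum n p y" using p by (intro psum_convex) auto
      then show "?T y \<in> B" using x0 y by (auto simp: mem_B space_lebesgue_n)
      \<comment> \<open>Since \<open>f y \<ge> - h\<close>, at least
        \<open>2 / 3 * h - 1 / 3 * h\<close> remains.\<close>
      have "f (?T y) = 2 / 3 * h + 1 / 3 * f y"
        unfolding x0(2)[symmetric] inner_n_def sum_distrib_left sum.distrib[symmetric]
        by (intro sum.cong) (auto simp: algebra_simps)
      moreover have "- h \<le> f y" using holder_ball[of y] y by (simp add: mem_B)
      ultimately show "h / 3 \<le> f (?T y)" by simp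
    qed
    moreover have "?E \<le> exp (\<bar>f z / t\<bar>\<^sup>2)" if "h / 3 \<le> f z" for z
    proof -
      have "h / 3 / t \<le> f z / t" using that t by (intro divide_right_mono) auto
      then have "(h / (3 * t))\<^sup>2 \<le> (f z / t)\<^sup>2" using h t by (intro power_mono) auto
      then show ?thesis by (simp only: power2_abs exp_le_cancel_iff)
    qed
    ultimately show "ennreal ?E * indicator B y \<le> ennreal (exp (\<bar>f (?T y) / t\<bar>\<^sup>2)) * indicator B (?T y)"
      by (auto simp: indicator_def intro!: ennreal_leI)
  qed auto
  also have "\<dots> = (\<integral>\<^sup>+ x. ennreal (exp (\<bar>f x / t\<bar>\<^sup>2)) * indicator B x \<partial>L)"
    by (rule nn_integral_lebesgue_n_affine[symmetric]) auto
  finally have le: "ennreal ((1 / 3) ^ n * (?E * vol)) \<le> (\<integral>\<^sup>+ x. ennreal (exp (\<bar>f x / t\<bar>\<^sup>2)) * indicator B x \<partial>L)" .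
  have "ennreal ((1 / 3) ^ n * ?E) = ennreal ((1 / 3) ^ n * (?E * vol)) / ennreal vol"
    using vol_pos by (simp add: divide_ennreal)
  also have "\<dots> \<le> (\<integral>\<^sup>+ x. ennreal (exp (\<bar>f x / t\<bar>\<^sup>2)) * indicator B x \<partial>L) / ennreal vol"
    by (rule divide_right_mono_ennreal) (rule le)
  also have "\<dots> = (\<integral>\<^sup>+ x. ennreal (exp (\<bar>f x / t\<bar>\<^sup>2)) \<partial>\<mu>)"
    by (subst nn_integral_uniform_measure) (auto simp: emeasure_B)
  also have "\<dots> \<le> ennreal 2" using adm by simp
  finally have "(1 / 3) ^ n * ?E \<le> 2" by (subst (asm) ennreal_le_iff) auto
  then have "?E \<le> 2 * 3 ^ n" by (simp add: power_divide field_simps)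
  \<comment> \<open>In exponential form the loss of volume costs only \<open>1 + 2 * n\<close> in
    the exponent, so \<open>(h / t)\<^sup>2\<close> is at most of order \<open>n\<close>.\<close>
  also have "\<dots> \<le> exp 1 * exp 2 ^ n"
  proof (intro mult_mono power_mono)
    show "(2::real) \<le> exp 1" "(3::real) \<le> exp 2"
      using exp_ge_add_one_self[of "1::real"] exp_ge_add_one_self[of "2::real"] by simp_all
  qed auto
  also have "\<dots> = exp (1 + 2 * real n)" by (simp add: exp_add mult.commute flip: exp_of_nat_mult)
  finally have "(h / (3 * t))\<^sup>2 \<le> 1 + 2 * real n" by simp
  also have "\<dots> \<le> 4 * real n" using n by simp
  also have "\<dots> = (2 * sqrt n)\<^sup>2" by (simp add: power_mult_distrib)
  finally have "h / (3 * t) \<le> 2 * sqrt n" by (rule power2_le_imp_le) simp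
  then show ?thesis using t n by (simp add: field_simps)
qed

lemma psi2_norm_ge: "ennreal (h / (6 * sqrt n)) \<le> psi2_norm \<mu> f"
  unfolding psi2_norm_def using psi2_admissible_ge by (intro Inf_greatest) (auto intro!: ennreal_leI)

end

section \<open>The variance\<close>

context dual_direction
begin

text \<open>Against the product weight every coordinate has the same second moment, a
  one-dimensional moment times \<open>exp_powr_mass p ^ (n - 1)\<close>; homogeneity of degree 2
  carries this to the ball. The constant is \<open>128 = 32 * 4\<close>.\<close>

lemma nn_integral_B_square_eq:
  assumes "i < n" "j < n"
  shows "(\<integral>\<^sup>+ x. ennreal ((x i)\<^sup>2) * indicator B x \<partial>L) = (\<integral>\<^sup>+ x. ennreal ((x j)\<^sup>2) * indicator B x \<partial>L)"
    and "(\<integral>\<^sup>+ x. ennreal ((x i)\<^sup>2) * indicator B x \<partial>L) \<le> ennreal (128 * real n powr (- (2 / p)) * vol)"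
proof -
  let ?m = "\<integral>\<^sup>+ t. ennreal (t\<^sup>2 * exp (- (\<bar>t\<bar> powr p))) \<partial>lborel" and ?Z = "exp_powr_mass p"
  have Z: "(\<integral>\<^sup>+ t. ennreal (exp (- (\<bar>t\<bar> powr p))) \<partial>lborel) = ennreal ?Z" "0 < ?Z"
    using exp_powr_mass p by auto
  have meas [measurable]: "(\<lambda>x. x l) \<in> borel_measurable L" if "l < n" for l
    using that by (rule measurable_lebesgue_n_component)
  have moment: "(\<integral>\<^sup>+ x. ennreal ((x l)\<^sup>2 * exp (- psum n p x)) \<partial>L) = ?m * ennreal (?Z ^ (n - 1))" if l: "l < n" for l
  proof -
    have "(x l)\<^sup>2 * exp (- psum n p x) = (\<Prod>i<n. (if i = l then (x i)\<^sup>2 else 1) * exp (- (\<bar>x i\<bar> powr p)))" for x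
      using l by (simp add: exp_psum_prod prod.distrib prod.If_cases)
    then have "(\<integral>\<^sup>+ x. ennreal ((x l)\<^sup>2 * exp (- psum n p x)) \<partial>L) =
       (\<integral>\<^sup>+ x. (\<Prod>i<n. ennreal ((if i = l then (x i)\<^sup>2 else 1) * exp (- (\<bar>x i\<bar> powr p)))) \<partial>L)"
      by (simp add: prod_ennreal)
    also have "\<dots> = (\<Prod>i<n. \<integral>\<^sup>+ t. ennreal ((if i = l then t\<^sup>2 else 1) * exp (- (\<bar>t\<bar> powr p))) \<partial>lborel)"
      by (rule nn_integral_lebesgue_n_prod) measurable
    also have "\<dots> = (\<Prod>i<n. if i = l then ?m else ennreal ?Z)"
      using Z by (intro prod.cong) auto
    also have "\<dots> = ?m * (\<Prod>i\<in>{..<n} - {l}. ennreal ?Z)"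
      using l by (subst prod.remove[of _ l]) (auto intro!: arg_cong2[where f="(*)"] prod.cong)
    also have "(\<Prod>i\<in>{..<n} - {l}. ennreal ?Z) = ennreal (?Z ^ (n - 1))"
      using l Z by (simp add: ennreal_power)
    finally show ?thesis .
  qed
  have hom: "((\<lambda>i\<in>{..<n}. c * x i) l)\<^sup>2 = c ^ 2 * (x l)\<^sup>2" if "l < n" for l c and x :: "nat \<Rightarrow> real"
    using that by (simp add: power_mult_distrib)
  let ?G = "Gamma (real (n + 2) / p + 1)"
  have G: "0 < ?G" using p by (intro Gamma_real_pos) (simp add: add_nonneg_pos)
  have eq: "?m * ennreal (?Z ^ (n - 1)) = ennreal ?G * (\<integral>\<^sup>+ x. ennreal ((x l)\<^sup>2) * indicator B x \<partial>L)" if l: "l < n" for l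
    unfolding moment[OF l, symmetric] using p l
    by (intro nn_integral_homogeneous_exp hom) auto
  have "ennreal ?G * (\<integral>\<^sup>+ x. ennreal ((x i)\<^sup>2) * indicator B x \<partial>L) = ennreal ?G * (\<integral>\<^sup>+ x. ennreal ((x j)\<^sup>2) * indicator B x \<partial>L)"
    by (rule trans[OF eq[OF assms(1), symmetric] eq[OF assms(2)]])
  then show "(\<integral>\<^sup>+ x. ennreal ((x i)\<^sup>2) * indicator B x \<partial>L) = (\<integral>\<^sup>+ x. ennreal ((x j)\<^sup>2) * indicator B x \<partial>L)"
    using G by (simp add: ennreal_mult_cancel_left)
  have "(\<integral>\<^sup>+ x. ennreal ((x i)\<^sup>2) * indicator B x \<partial>L) \<le> ennreal (32 * (p / n) powr (real 2 / p) * vol)"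
  proof (rule ball_integral_le)
    have "?m * ennreal (?Z ^ (n - 1)) \<le> ennreal (32 * ?Z) * ennreal (?Z ^ (n - 1))"
      by (rule mult_right_mono[OF nn_integral_exp_powr_second_moment[OF p(1)]]) simp
    also have "\<dots> = ennreal (32 * ?Z * ?Z ^ (n - 1))"
      using Z by (simp add: ennreal_mult)
    also have "32 * ?Z * ?Z ^ (n - 1) = 32 * ?Z ^ n"
      using n by (simp add: power_eq_if)
    finally show "(\<integral>\<^sup>+ x. ennreal ((x i)\<^sup>2 * exp (- psum n p x)) \<partial>L) \<le> ennreal (32 * ?Z ^ n)"
      using moment[OF assms(1)] by simp
    show "((\<lambda>i\<in>{..<n}. c * x i) i)\<^sup>2 = c ^ 2 * (x i)\<^sup>2" for c and x :: "nat \<Rightarrow> real"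
      using assms by (rule_tac hom)
  qed (use p n assms in auto)
  also have "32 * (p / n) powr (real 2 / p) * vol \<le> 128 * real n powr (- (2 / p)) * vol"
  proof (rule mult_right_mono)
    have "(p / n) powr (real 2 / p) = p powr (2 / p) * real n powr (- (2 / p))"
      using powr_two_over[of p n] p n by simp
    also have "\<dots> \<le> 4 * real n powr (- (2 / p))"
      using powr_self_inverse_le[OF p] by (intro mult_right_mono) auto
    finally show "32 * (p / n) powr (real 2 / p) \<le> 128 * real n powr (- (2 / p))" by simp
  qed (use vol_pos in simp)
  finally show "(\<integral>\<^sup>+ x. ennreal ((x i)\<^sup>2) * indicator B x \<partial>L) \<le> ennreal (128 * real n powr (- (2 / p)) * vol)"
    by (simp add: ennreal_leI)
qed

text \<open>Coordinate 0 exists since \<open>1 \<le> n\<close>, and it represents all coordinates.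
  The integral is not divided by the volume.\<close>

abbreviation "J \<equiv> \<integral>\<^sup>+ x. ennreal ((x 0)\<^sup>2) * indicator B x \<partial>L"

lemma nn_integral_B_square: "i < n \<Longrightarrow> (\<integral>\<^sup>+ x. ennreal ((x i)\<^sup>2) * indicator B x \<partial>L) = J"
  using n by (intro nn_integral_B_square_eq) auto

lemma J_le: "J \<le> ennreal (128 * real n powr (- (2 / p)) * vol)"
  using n nn_integral_B_square_eq(2)[of 0 0] by simp

text \<open>Reflecting the coordinate \<open>j\<close> kills the mixed term of \<open>(g + \<theta> j * x j)\<^sup>2\<close> when \<open>g\<close> does not
  depend on that coordinate.\<close>

lemma nn_integral_B_partial_inner:
  "m \<le> n \<Longrightarrow> (\<integral>\<^sup>+ x. ennreal ((\<Sum>i<m. x i * \<theta> i)\<^sup>2) * indicator B x \<partial>L) = ennreal (\<Sum>i<m. (\<theta> i)\<^sup>2) * J"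
proof (induction m)
  case (Suc j)
  have meas [measurable]: "(\<lambda>x. x l) \<in> borel_measurable L" if "l < n" for l
    using that by (rule measurable_lebesgue_n_component)
  define g where "g x = (\<Sum>i<j. x i * \<theta> i)" for x :: "nat \<Rightarrow> real"
  have j: "j < n" using Suc by simp
  have sums [measurable]: "g \<in> borel_measurable L"
    unfolding g_def using Suc.prems by (intro borel_measurable_sum) auto
  let ?R = "\<lambda>x. \<lambda>i\<in>{..<n}. 0 + (if i = j then -1 else 1) * x i"
  have R: "g (?R x) = g x" "?R x j = - x j" "?R x \<in> B \<longleftrightarrow> x \<in> B" if "x \<in> space L" for x
  proof -
    show "g (?R x) = g x" unfolding g_def using j by (intro sum.cong) auto
    show "?R x j = - x j" using j by simp
    have "psum n p (?R x) = psum n p x" unfolding psum_def by (intro sum.cong) auto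
    then show "?R x \<in> B \<longleftrightarrow> x \<in> B" using that by (simp add: mem_B space_lebesgue_n)
  qed
  let ?I = "\<integral>\<^sup>+ x. ennreal ((g x + x j * \<theta> j)\<^sup>2) * indicator B x \<partial>L"
  have "?I = (\<Prod>i<n. ennreal \<bar>if i = j then -1 else 1\<bar>) *
      (\<integral>\<^sup>+ x. ennreal ((g (?R x) + ?R x j * \<theta> j)\<^sup>2) * indicator B (?R x) \<partial>L)"
    using j by (intro nn_integral_lebesgue_n_affine) auto
  also have "(\<Prod>i<n. ennreal \<bar>if i = j then -1 else 1\<bar>) = 1" by (intro prod.neutral) auto
  also have "1 * (\<integral>\<^sup>+ x. ennreal ((g (?R x) + ?R x j * \<theta> j)\<^sup>2) * indicator B (?R x) \<partial>L)
     = (\<integral>\<^sup>+ x. ennreal ((g x - x j * \<theta> j)\<^sup>2) * indicator B x \<partial>L)"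
    unfolding mult_1 using R by (intro nn_integral_cong) (simp add: indicator_def)
  finally have I: "?I = (\<integral>\<^sup>+ x. ennreal ((g x - x j * \<theta> j)\<^sup>2) * indicator B x \<partial>L)" .
  \<comment> \<open>Adding the integral to its reflected form leaves twice the sum of the two
    squares.\<close>
  have "2 * ?I = ?I + (\<integral>\<^sup>+ x. ennreal ((g x - x j * \<theta> j)\<^sup>2) * indicator B x \<partial>L)"
    using I by (simp add: mult_2)
  also have "\<dots> = (\<integral>\<^sup>+ x. ennreal ((g x + x j * \<theta> j)\<^sup>2) * indicator B x + ennreal ((g x - x j * \<theta> j)\<^sup>2) * indicator B x \<partial>L)"
    using j by (intro nn_integral_add[symmetric]) auto
  also have "\<dots> = (\<integral>\<^sup>+ x. 2 * (ennreal ((g x)\<^sup>2) * indicator B x + ennreal ((\<theta> j)\<^sup>2) * (ennreal ((x j)\<^sup>2) * indicator B x)) \<partial>L)"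
  proof (rule nn_integral_cong)
    fix x
    have "(g x + x j * \<theta> j)\<^sup>2 + (g x - x j * \<theta> j)\<^sup>2 = 2 * ((g x)\<^sup>2 + (\<theta> j)\<^sup>2 * (x j)\<^sup>2)"
      by (simp add: power2_eq_square algebra_simps)
    then have "ennreal ((g x + x j * \<theta> j)\<^sup>2) + ennreal ((g x - x j * \<theta> j)\<^sup>2) = ennreal (2 * ((g x)\<^sup>2 + (\<theta> j)\<^sup>2 * (x j)\<^sup>2))"
      by (metis ennreal_plus zero_le_power2)
    also have "\<dots> = 2 * (ennreal ((g x)\<^sup>2) + ennreal ((\<theta> j)\<^sup>2) * ennreal ((x j)\<^sup>2))"
      by (subst ennreal_mult) (auto simp: ennreal_mult)
    finally show "ennreal ((g x + x j * \<theta> j)\<^sup>2) * indicator B x + ennreal ((g x - x j * \<theta> j)\<^sup>2) * indicator B x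
      = 2 * (ennreal ((g x)\<^sup>2) * indicator B x + ennreal ((\<theta> j)\<^sup>2) * (ennreal ((x j)\<^sup>2) * indicator B x))"
      by (simp add: indicator_def)
  qed
  also have "\<dots> = 2 * ((\<integral>\<^sup>+ x. ennreal ((g x)\<^sup>2) * indicator B x \<partial>L) + ennreal ((\<theta> j)\<^sup>2) * (\<integral>\<^sup>+ x. ennreal ((x j)\<^sup>2) * indicator B x \<partial>L))"
    using j by (simp add: nn_integral_cmult nn_integral_add)
  also have "(\<integral>\<^sup>+ x. ennreal ((x j)\<^sup>2) * indicator B x \<partial>L) = J" using j by (rule nn_integral_B_square)
  also have "(\<integral>\<^sup>+ x. ennreal ((g x)\<^sup>2) * indicator B x \<partial>L) = ennreal (\<Sum>i<j. (\<theta> i)\<^sup>2) * J"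
    unfolding g_def using Suc by simp
  finally have double: "2 * ?I = 2 * (ennreal (\<Sum>i<j. (\<theta> i)\<^sup>2) * J + ennreal ((\<theta> j)\<^sup>2) * J)" .
  have "a = b" if "2 * a = 2 * b" for a b :: ennreal
    using that by (simp add: ennreal_mult_cancel_left)
  from this[OF double] have "?I = ennreal (\<Sum>i<j. (\<theta> i)\<^sup>2) * J + ennreal ((\<theta> j)\<^sup>2) * J" .
  also have "\<dots> = ennreal (\<Sum>i<Suc j. (\<theta> i)\<^sup>2) * J"
    by (simp add: sum_nonneg ennreal_plus distrib_right)
  finally show ?case by (simp add: g_def)
qed simp

section \<open>Lower bound for the second moment of a coordinate\<close>

text \<open>The power mean inequality read backwards: outside the half ball the Euclidean norm
  cannot be small. The 4 comes from raising \<open>1 / 2 powr p\<close> to the power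
  \<open>2 / p\<close>, which isolates the sum of squares.\<close>

lemma shell_bound:
  assumes x: "x \<in> space L" "1 / 2 powr p < psum n p x"
  shows "real n powr (1 - 2 / p) / 4 \<le> (\<Sum>i<n. (x i)\<^sup>2)"
proof -
  let ?S = "\<Sum>i<n. (x i)\<^sup>2"
  have S: "0 \<le> ?S" by (simp add: sum_nonneg)
  have "1 / 2 powr p \<le> real n powr (1 - p / 2) * ?S powr (p / 2)"
    using x psum_le_square_sum[OF p n, of x] by linarith
  then have "(1 / 2 powr p) powr (2 / p) \<le> (real n powr (1 - p / 2) * ?S powr (p / 2)) powr (2 / p)"
    using p by (intro powr_mono2) auto
  also have "(1 / 2 powr p) powr (2 / p) = 1 / 4" using p by (simp add: powr_divide powr_powr)
  also have "(real n powr (1 - p / 2) * ?S powr (p / 2)) powr (2 / p) = real n powr ((1 - p / 2) * (2 / p)) * ?S"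
    using p S by (simp add: powr_mult powr_powr)
  also have "(1 - p / 2) * (2 / p) = - (1 - 2 / p)" using p by (simp add: field_simps)
  finally have "1 / 4 \<le> ?S / real n powr (1 - 2 / p)" by (simp only: powr_minus divide_inverse mult.commute)
  then show ?thesis using n by (simp add: pos_le_divide_eq)
qed

text \<open>The half ball is a dilate by \<open>1 / 2\<close>, so it has the fraction
  \<open>(1 / 2) ^ n\<close> of the volume, at most one half as \<open>1 \<le> n\<close>.\<close>

lemma volume_half_ball_le:
  "(\<integral>\<^sup>+ x. indicator {x \<in> space L. psum n p x \<le> 1 / 2 powr p} x \<partial>L) \<le> ennreal (vol / 2)"
proof -
  let ?H = "{x \<in> space L. psum n p x \<le> 1 / 2 powr p}"
  have H: "?H \<in> sets L" by measurable
  have "(\<integral>\<^sup>+ x. indicator ?H x \<partial>L) = (\<Prod>i<n. ennreal \<bar>1 / 2\<bar>) * (\<integral>\<^sup>+ x. indicator ?H (\<lambda>i\<in>{..<n}. 0 + 1 / 2 * x i) \<partial>L)"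
    using H by (intro nn_integral_lebesgue_n_affine) auto
  also have "(\<integral>\<^sup>+ x. indicator ?H (\<lambda>i\<in>{..<n}. 0 + 1 / 2 * x i) \<partial>L) = (\<integral>\<^sup>+ x. indicator B x \<partial>L)"
  proof (rule nn_integral_cong)
    fix x assume x: "x \<in> space L"
    have "psum n p (\<lambda>i\<in>{..<n}. 0 + 1 / 2 * x i) = psum n p x / 2 powr p"
      using psum_scale[of "1 / 2" n p x] by (simp add: powr_divide)
    then have "(\<lambda>i\<in>{..<n}. 0 + 1 / 2 * x i) \<in> ?H \<longleftrightarrow> x \<in> B"
      using x by (simp add: mem_B space_lebesgue_n divide_le_cancel)
    then show "indicator ?H (\<lambda>i\<in>{..<n}. 0 + 1 / 2 * x i) = (indicator B x :: ennreal)"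
      by (simp add: indicator_def)
  qed
  also have "\<dots> = ennreal vol" by (simp add: emeasure_B)
  also have "(\<Prod>i<n. ennreal \<bar>1 / 2\<bar>) * ennreal vol = ennreal ((1 / 2) ^ n * vol)"
  proof -
    have "(\<Prod>i<n. ennreal \<bar>1 / 2\<bar>) = ennreal ((1 / 2) ^ n)"
      by (subst prod_ennreal) auto
    then show ?thesis using vol_pos by (simp only:) (intro ennreal_mult[symmetric], auto)
  qed
  also have "\<dots> \<le> ennreal (1 / 2 * vol)"
    using vol_pos n power_decreasing[of 1 n "1 / 2 :: real"] by (intro ennreal_leI mult_right_mono) auto
  finally show ?thesis by simp
qed

text \<open>Off the half ball the squares sum to at least \<open>?c\<close>, and at least half of
  the volume lies there. All \<open>n\<close> coordinates contribute equally, hence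
  \<open>n * J \<ge> ?c * vol / 2\<close>.\<close>

lemma J_ge: "ennreal (real n powr (- (2 / p)) / 8 * vol) \<le> J"
proof -
  have meas [measurable]: "(\<lambda>x. x l) \<in> borel_measurable L" if "l < n" for l
    using that by (rule measurable_lebesgue_n_component)
  let ?c = "real n powr (1 - 2 / p) / 4"
  let ?H = "{x \<in> space L. psum n p x \<le> 1 / 2 powr p}"
  have H [measurable]: "?H \<in> sets L" by measurable
  have sq_meas: "(\<lambda>x. ennreal ((x i)\<^sup>2) * indicator B x) \<in> borel_measurable L" if "i < n" for i
    using that by measurable
  have sum_meas: "(\<lambda>x. \<Sum>i<n. ennreal ((x i)\<^sup>2) * indicator B x) \<in> borel_measurable L"
    by (rule borel_measurable_sum) (rule sq_meas, simp)
  have c: "0 < ?c" using n by simp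
  have "ennreal (?c * vol) = ennreal ?c * ennreal vol"
    using c vol_pos by (intro ennreal_mult) auto
  also have "\<dots> = (\<integral>\<^sup>+ x. ennreal ?c * indicator B x \<partial>L)"
    by (simp add: nn_integral_cmult_indicator emeasure_B)
  \<comment> \<open>Adding the half ball on the right avoids a subtraction in
    \<open>ennreal\<close>.\<close>
  also have "\<dots> \<le> (\<integral>\<^sup>+ x. (\<Sum>i<n. ennreal ((x i)\<^sup>2) * indicator B x) + ennreal ?c * indicator ?H x \<partial>L)"
  proof (rule nn_integral_mono)
    fix x assume x: "x \<in> space L"
    show "ennreal ?c * indicator B x \<le> (\<Sum>i<n. ennreal ((x i)\<^sup>2) * indicator B x) + ennreal ?c * indicator ?H x"
    proof (cases "x \<in> B \<and> x \<notin> ?H")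
      case True
      then have "ennreal ?c \<le> ennreal (\<Sum>i<n. (x i)\<^sup>2)"
        using x by (intro ennreal_leI shell_bound) auto
      also have "\<dots> = (\<Sum>i<n. ennreal ((x i)\<^sup>2))" by (simp add: sum_ennreal)
      finally show ?thesis using True by simp
    next
      case False
      then show ?thesis by (auto simp: indicator_def)
    qed
  qed
  also have "\<dots> = (\<integral>\<^sup>+ x. (\<Sum>i<n. ennreal ((x i)\<^sup>2) * indicator B x) \<partial>L) + (\<integral>\<^sup>+ x. ennreal ?c * indicator ?H x \<partial>L)"
    by (rule nn_integral_add[OF sum_meas]) measurable
  also have "(\<integral>\<^sup>+ x. (\<Sum>i<n. ennreal ((x i)\<^sup>2) * indicator B x) \<partial>L) = (\<Sum>i<n. \<integral>\<^sup>+ x. ennreal ((x i)\<^sup>2) * indicator B x \<partial>L)"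
    by (rule nn_integral_sum) (rule sq_meas, simp)
  also have "(\<integral>\<^sup>+ x. ennreal ?c * indicator ?H x \<partial>L) = ennreal ?c * (\<integral>\<^sup>+ x. indicator ?H x \<partial>L)"
    by (rule nn_integral_cmult) auto
  also have "(\<Sum>i<n. \<integral>\<^sup>+ x. ennreal ((x i)\<^sup>2) * indicator B x \<partial>L) = (\<Sum>i<n. J)"
    by (intro sum.cong nn_integral_B_square) auto
  also have "\<dots> = ennreal n * J"
    by (simp only: sum_constant card_lessThan ennreal_of_nat_eq_real_of_nat)
  also have "ennreal n * J + ennreal ?c * (\<integral>\<^sup>+ x. indicator ?H x \<partial>L) \<le> ennreal n * J + ennreal ?c * ennreal (vol / 2)"
    by (intro add_left_mono mult_left_mono volume_half_ball_le) auto
  finally have main: "ennreal (?c * vol) \<le> ennreal n * J + ennreal ?c * ennreal (vol / 2)" .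
  \<comment> \<open>Finiteness of \<open>J\<close> allows the inequality to be rearranged in the
    reals.\<close>
  have "J < \<infinity>" using J_le by (rule order.strict_trans1) simp
  then obtain r where r: "J = ennreal r" "0 \<le> r" by (cases J) auto
  have "ennreal n * J = ennreal (n * r)"
    unfolding r(1) using r(2) by (intro ennreal_mult[symmetric]) auto
  moreover have "ennreal ?c * ennreal (vol / 2) = ennreal (?c * (vol / 2))"
    using c vol_pos by (intro ennreal_mult[symmetric]) auto
  moreover have "ennreal (n * r) + ennreal (?c * (vol / 2)) = ennreal (n * r + ?c * (vol / 2))"
    using r(2) c vol_pos by (intro ennreal_plus[symmetric]) auto
  ultimately have "ennreal n * J + ennreal ?c * ennreal (vol / 2) = ennreal (n * r + ?c * (vol / 2))"
    by (simp only:)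
  with main have "ennreal (?c * vol) \<le> ennreal (n * r + ?c * (vol / 2))" by (simp only:)
  moreover have "0 \<le> n * r + ?c * (vol / 2)" using r(2) c vol_pos by (intro add_nonneg_nonneg mult_nonneg_nonneg) auto
  ultimately have "?c * vol \<le> n * r + ?c * (vol / 2)" by (simp only: ennreal_le_iff)
  then have "?c / n * vol / 2 \<le> r" using n by (simp add: field_simps)
  moreover have "real n powr (1 - 2 / p) / n = real n powr (- (2 / p))"
    using n by (simp add: powr_diff powr_minus_divide)
  then have "real n powr (1 - 2 / p) / n / 8 * vol = real n powr (- (2 / p)) / 8 * vol"
    by (simp only:)
  then have "?c / n * vol / 2 = real n powr (- (2 / p)) / 8 * vol" by simp
  ultimately show ?thesis using r by (simp add: ennreal_leI)
qed

section \<open>Standard deviation and best constant\<close>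

text \<open>The squares of the entries of \<theta> sum to 1, so the second moment of the functional
  is \<open>J\<close> divided by the volume.\<close>

lemma second_moment_bounds:
  "real n powr (- (2 / p)) / 8 \<le> (\<integral>x. \<bar>f x\<bar>\<^sup>2 \<partial>\<mu>)"
  "(\<integral>x. \<bar>f x\<bar>\<^sup>2 \<partial>\<mu>) \<le> 128 * real n powr (- (2 / p))"
proof -
  have "J < \<infinity>" using J_le by (rule order.strict_trans1) simp
  then obtain r where r: "J = ennreal r" "0 \<le> r" by (cases J) auto
  have "(\<integral>\<^sup>+ x. ennreal (\<bar>f x\<bar>\<^sup>2) \<partial>\<mu>) = (\<integral>\<^sup>+ x. ennreal ((f x)\<^sup>2) * indicator B x \<partial>L) / ennreal vol"
    by (subst nn_integral_uniform_measure) (auto simp: emeasure_B)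
  also have "(\<integral>\<^sup>+ x. ennreal ((f x)\<^sup>2) * indicator B x \<partial>L) = J"
    using nn_integral_B_partial_inner[of n] by (simp add: inner_n_def square_sum_\<theta>)
  also have "J / ennreal vol = ennreal (r / vol)"
    using r vol_pos by (simp add: divide_ennreal)
  finally have "(\<integral>\<^sup>+ x. ennreal (\<bar>f x\<bar>\<^sup>2) \<partial>\<mu>) = ennreal (r / vol)" .
  then have eq: "(\<integral>x. \<bar>f x\<bar>\<^sup>2 \<partial>\<mu>) = r / vol"
    using r vol_pos by (subst integral_eq_nn_integral) auto
  show "real n powr (- (2 / p)) / 8 \<le> (\<integral>x. \<bar>f x\<bar>\<^sup>2 \<partial>\<mu>)"
    unfolding eq using J_ge r vol_pos by (simp add: pos_le_divide_eq ennreal_le_iff)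
  show "(\<integral>x. \<bar>f x\<bar>\<^sup>2 \<partial>\<mu>) \<le> 128 * real n powr (- (2 / p))"
    unfolding eq using J_le r vol_pos by (simp add: pos_divide_le_eq ennreal_le_iff)
qed

lemma standard_deviation_bounds:
  "real n powr (- (1 / p)) / 3 \<le> sqrt (\<integral>x. \<bar>f x\<bar>\<^sup>2 \<partial>\<mu>)"
  "sqrt (\<integral>x. \<bar>f x\<bar>\<^sup>2 \<partial>\<mu>) \<le> 12 * real n powr (- (1 / p))"
proof -
  have sq: "(real n powr (- (1 / p)))\<^sup>2 = real n powr (- (2 / p))"
    using n by (simp add: powr_powr flip: powr_realpow)
  show "real n powr (- (1 / p)) / 3 \<le> sqrt (\<integral>x. \<bar>f x\<bar>\<^sup>2 \<partial>\<mu>)"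
  proof (rule real_le_rsqrt)
    \<comment> \<open>Enlarging 8 to 9 here, and 128 to 144 below, produces perfect squares.\<close>
    have "(real n powr (- (1 / p)) / 3)\<^sup>2 = real n powr (- (2 / p)) / 9"
      by (simp add: power_divide sq)
    also have "\<dots> \<le> real n powr (- (2 / p)) / 8" by simp
    finally show "(real n powr (- (1 / p)) / 3)\<^sup>2 \<le> (\<integral>x. \<bar>f x\<bar>\<^sup>2 \<partial>\<mu>)"
      using second_moment_bounds(1) by (rule order.trans)
  qed
  show "sqrt (\<integral>x. \<bar>f x\<bar>\<^sup>2 \<partial>\<mu>) \<le> 12 * real n powr (- (1 / p))"
  proof (rule real_le_lsqrt)
    have "128 * real n powr (- (2 / p)) \<le> 144 * real n powr (- (2 / p))" by simp
    also have "\<dots> = (12 * real n powr (- (1 / p)))\<^sup>2" by (simp add: power_mult_distrib sq)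
    finally show "(\<integral>x. \<bar>f x\<bar>\<^sup>2 \<partial>\<mu>) \<le> (12 * real n powr (- (1 / p)))\<^sup>2"
      by (rule order.trans[OF second_moment_bounds(2)])
  qed simp
qed

text \<open>The smallest constant is the Orlicz norm divided by the standard deviation. Each bound
  of the norm is paired with the opposite bound of the deviation: \<open>72 = 6 * 12\<close> below,
  and the factor 3 above comes from the lower bound \<open>a / 3\<close>.\<close>

lemma best_constant_bounds:
  obtains K where "best_psi2_constant n B \<theta> K"
    "1 / 72 * real n powr (1 / p - 1 / 2) * h \<le> K"
    "K \<le> 3 * sqrt (2 * M) * real n powr (1 / p - 1 / 2) * h"
proof -
  define \<sigma> where "\<sigma> = sqrt (\<integral>x. \<bar>f x\<bar>\<^sup>2 \<partial>\<mu>)"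
  define a where "a = real n powr (- (1 / p))"
  have a: "0 < a" using n by (simp add: a_def)
  have \<sigma>: "a / 3 \<le> \<sigma>" "\<sigma> \<le> 12 * a"
    using standard_deviation_bounds by (simp_all add: \<sigma>_def a_def)
  then have \<sigma>_pos: "0 < \<sigma>" using a by linarith
  have h: "0 < h" by (rule dual_norm_pos)
  have scale: "h / sqrt n / a = real n powr (1 / p - 1 / 2) * h"
  proof -
    have "real n powr (1 / p - 1 / 2) = real n powr (1 / p) / sqrt n"
      unfolding powr_diff by (simp add: powr_half_sqrt)
    then show ?thesis by (simp add: a_def powr_minus_divide)
  qed
  have "psi2_norm \<mu> f < \<infinity>" using psi2_norm_le by (rule order.strict_trans1) simp
  then obtain r where r: "psi2_norm \<mu> f = ennreal r" "0 \<le> r"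
    by (cases "psi2_norm \<mu> f") auto
  have r_ge: "h / (6 * sqrt n) \<le> r" using psi2_norm_ge r by (simp add: ennreal_le_iff)
  have r_le: "r \<le> sqrt (2 * M) * h / sqrt n"
    using psi2_norm_le r h by (simp add: ennreal_le_iff)
  have r_pos: "0 < r"
  proof -
    have "0 < h / (6 * sqrt n)" using h n by simp
    then show ?thesis using r_ge by linarith
  qed
  \<comment> \<open>As \<sigma> is positive, the admissible constants are the positive numbers from
    \<open>r / \<sigma>\<close> on; \<open>r > 0\<close> makes this minimum itself
    admissible.\<close>
  have dir: "psi2_direction n B \<theta> K' \<longleftrightarrow> 0 < K' \<and> r \<le> K' * \<sigma>" for K'
    unfolding psi2_direction_def Let_def \<sigma>_def[symmetric] r(1)
    using \<sigma>_pos by (auto simp: ennreal_le_iff)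
  have "best_psi2_constant n B \<theta> (r / \<sigma>)"
    unfolding best_psi2_constant_def dir using r_pos \<sigma>_pos by (auto simp: pos_divide_le_eq)
  moreover have "1 / 72 * real n powr (1 / p - 1 / 2) * h \<le> r / \<sigma>"
  proof -
    have "1 / 72 * real n powr (1 / p - 1 / 2) * h = h / (6 * sqrt n) / (12 * a)"
      unfolding mult.assoc scale[symmetric] by simp
    also have "\<dots> \<le> r / \<sigma>" using r_ge r_pos \<sigma> \<sigma>_pos a by (intro frac_le) auto
    finally show ?thesis .
  qed
  moreover have "r / \<sigma> \<le> 3 * sqrt (2 * M) * real n powr (1 / p - 1 / 2) * h"
  proof -
    have "r / \<sigma> \<le> (sqrt (2 * M) * h / sqrt n) / (a / 3)"
      using r_le \<sigma> a h by (intro frac_le) auto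
    also have "\<dots> = 3 * sqrt (2 * M) * (h / sqrt n / a)" by simp
    finally show ?thesis unfolding scale by (simp add: mult.assoc)
  qed
  ultimately show ?thesis using that by blast
qed

end

theorem proposition11:
  "\<exists>c C :: real. 0 < c \<and> 0 < C \<and>
     (\<forall>(p::real) (p'::ennreal) (n::nat) (\<theta>::nat \<Rightarrow> real).
        1 \<le> p \<and> p \<le> 2 \<and> 1 / ennreal p + 1 / p' = 1 \<and> 1 \<le> n \<and> \<theta> \<in> sphere_n n \<longrightarrow>
        (\<exists>K. psi2_direction n (lp_ball n (ennreal p)) \<theta> K) \<and>
        (\<exists>C\<^sub>\<theta>. best_psi2_constant n (lp_ball n (ennreal p)) \<theta> C\<^sub>\<theta> \<and>
           c * real n powr (1 / p - 1 / 2) * lp_norm n p' \<theta> \<le> C\<^sub>\<theta> \<and>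
           C\<^sub>\<theta> \<le> C * real n powr (1 / p - 1 / 2) * lp_norm n p' \<theta>))"
proof (rule exI[of _ "1 / 72 :: real"], rule exI[of _ "3 * sqrt (2 * (64 * exp 7)) :: real"], intro conjI allI impI)
  fix p :: real and p' :: ennreal and n :: nat and \<theta> :: "nat \<Rightarrow> real"
  assume "1 \<le> p \<and> p \<le> 2 \<and> 1 / ennreal p + 1 / p' = 1 \<and> 1 \<le> n \<and> \<theta> \<in> sphere_n n"
  then interpret dual_direction p p' n \<theta> by unfold_locales auto
  \<comment> \<open>The constant \<open>M\<close> appears written out, because the witnesses are
    chosen before \<open>p\<close>, \<open>n\<close> and \<theta> are fixed.\<close>
  obtain K where K: "best_psi2_constant n (lp_ball n (ennreal p)) \<theta> K"
    "1 / 72 * real n powr (1 / p - 1 / 2) * lp_norm n p' \<theta> \<le> K"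
    "K \<le> 3 * sqrt (2 * (64 * exp 7)) * real n powr (1 / p - 1 / 2) * lp_norm n p' \<theta>"
    by (rule best_constant_bounds)
  then show "\<exists>K. psi2_direction n (lp_ball n (ennreal p)) \<theta> K"
    by (auto simp: best_psi2_constant_def)
  show "\<exists>C\<^sub>\<theta>. best_psi2_constant n (lp_ball n (ennreal p)) \<theta> C\<^sub>\<theta> \<and>
    1 / 72 * real n powr (1 / p - 1 / 2) * lp_norm n p' \<theta> \<le> C\<^sub>\<theta> \<and>
    C\<^sub>\<theta> \<le> 3 * sqrt (2 * (64 * exp 7)) * real n powr (1 / p - 1 / 2) * lp_norm n p' \<theta>"
    using K by blast
qed simp_all

end
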